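(* There exist a constant $C$ and a polynomial $q$ such that the following holds. Let $P\subseteq\mathbb{R}^n$ be a polytope which is the solution set of some system $Ax\le b$, where $A$ is a rational $m\times n$ matrix ($m$ arbitrary, possibly exponential in $n$) and $b$ a rational vector, let $\psi$ be the maximum bitlength of an entry of $A$, and put $\|P\|=n+\psi$. Then the saturation index of the Ehrhart quasi-polynomial $f_P$ satisfies $s(f_P)\le C\cdot 2^{q(\|P\|)}$; in particular the bitlength of $s(f_P)$ is $O({\rm poly}(\|P\|))$.
   Context: $f_P(k)=\#(kP\cap\mathbb{Z}^n)$ for $k\ge0$. For a quasi-polynomial $f$ with constituent polynomials $f_1,\dots,f_l$ ($f(k)=f_j(k)$ for $k\equiv j\pmod l$, $l$ the period), $f$ is strictly saturated if every $f_i$ that is not identically zero satisfies $f_i(k)>0$ for all integers $k\ge1$; the saturation index $s(f)$ is the smallest nonnegative integer $s$ such that $k\mapsto f(k+s)$ is strictly saturated.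
   Formalization: Here ψ is the maximum of the bitlengths of the entries of A and of the denominators of b; with ψ taken over A alone and b an arbitrary rational vector the claim fails, e.g. for P=[1/3, 1/3+1/(3j)], j=3t+1, where s(f_P)≥j. For integral b nothing changes. *)

theory Defs
  imports
    "Jordan_Normal_Form.Matrix"
    "HOL-Computational_Algebra.Polynomial"
    "HOL-Library.Log_Nat"
    "HOL-Number_Theory.Cong"
begin

text \<open>The dimension has to be quantified after the constant and the polynomial of the theorem, so
  \<open>\<real>\<^sup>n\<close> is the set \<open>carrier_vec n\<close> of real vectors of length \<open>n\<close>.\<close>

definition solution_set :: "nat \<Rightarrow> rat mat \<Rightarrow> rat vec \<Rightarrow> real vec set" where
  "solution_set n A b =
     {x \<in> carrier_vec n. map_mat real_of_rat A *\<^sub>v x \<le> map_vec real_of_rat b}"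

definition bounded_in :: "nat \<Rightarrow> real vec set \<Rightarrow> bool" where
  "bounded_in n P \<longleftrightarrow> P \<subseteq> carrier_vec n \<and> (\<exists>B. \<forall>x\<in>P. \<forall>i<n. \<bar>x $ i\<bar> \<le> B)"

definition integer_points :: "nat \<Rightarrow> real vec set" where
  "integer_points n = {x \<in> carrier_vec n. \<forall>i<n. x $ i \<in> \<int>}"

definition ehrhart :: "nat \<Rightarrow> real vec set \<Rightarrow> nat \<Rightarrow> nat" where
  "ehrhart n P k = card ((\<lambda>x. real k \<cdot>\<^sub>v x) ` P \<inter> integer_points n)"

definition constituents :: "(nat \<Rightarrow> real) \<Rightarrow> nat \<Rightarrow> (nat \<Rightarrow> real poly) \<Rightarrow> bool" where
  "constituents f l c \<longleftrightarrow>
     l \<ge> 1 \<and> (\<forall>j\<in>{1..l}. \<forall>k. [k = j] (mod l) \<longrightarrow> f k = poly (c j) (real k))"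

definition quasi_polynomial :: "(nat \<Rightarrow> real) \<Rightarrow> bool" where
  "quasi_polynomial f \<longleftrightarrow> (\<exists>l c. constituents f l c)"

text \<open>The choice of the period \<open>l\<close> is immaterial, see \<open>constituents_unique\<close> below.\<close>

definition strictly_saturated :: "(nat \<Rightarrow> real) \<Rightarrow> bool" where
  "strictly_saturated f \<longleftrightarrow>
     (\<exists>l c. constituents f l c \<and>
        (\<forall>j\<in>{1..l}. c j \<noteq> 0 \<longrightarrow> (\<forall>k::nat. k \<ge> 1 \<longrightarrow> poly (c j) (real k) > 0)))"

definition saturation_index :: "(nat \<Rightarrow> real) \<Rightarrow> nat" where
  "saturation_index f = (LEAST s. strictly_saturated (\<lambda>k. f (k + s)))"

lemma constituents_unique:
  assumes "constituents f l c" "constituents f l' c'" "j \<in> {1..l}"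
  shows "\<exists>j'\<in>{1..l'}. c' j' = c j"
proof -
  have l: "l \<ge> 1" "l' \<ge> 1" using assms by (auto simp: constituents_def)
  define j' where "j' = (if j mod l' = 0 then l' else j mod l')"
  have j': "j' \<in> {1..l'}"
    using l by (auto simp: j'_def intro: less_imp_le)
  have *: "poly (c' j' - c j) (real (j + t * (l * l'))) = 0" for t
  proof -
    have "[j + t * (l * l') = j] (mod l)" "[j + t * (l * l') = j'] (mod l')"
      by (auto simp: cong_def j'_def mod_add_right_eq[symmetric] mult.assoc[symmetric])
    hence "f (j + t * (l * l')) = poly (c j) (real (j + t * (l * l')))"
      "f (j + t * (l * l')) = poly (c' j') (real (j + t * (l * l')))"
      using assms j' unfolding constituents_def by blast+
    thus ?thesis by (simp only: poly_diff)
  qed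
  have "inj (\<lambda>t. real (j + t * (l * l')))"
    using l by (auto simp: inj_def)
  hence "infinite (range (\<lambda>t. real (j + t * (l * l'))))"
    by (rule range_inj_infinite)
  hence "infinite {x. poly (c' j' - c j) x = 0}"
    by (rule contrapos_nn) (erule finite_subset[rotated], use * in blast)
  hence "c' j' - c j = 0" using poly_roots_finite by blast
  with j' show ?thesis by auto
qed

text \<open>One bit for the sign plus the binary digits of numerator and denominator in lowest terms.\<close>

definition bitlength_rat :: "rat \<Rightarrow> nat" where
  "bitlength_rat r =
     1 + floorlog 2 (nat \<bar>fst (quotient_of r)\<bar>) + floorlog 2 (nat (snd (quotient_of r)))"

text \<open>The maximum of the bitlengths of the entries of \<open>A\<close> and of the denominators of \<open>b\<close>.
  For integral \<open>b\<close> (and a nonempty matrix) this is the maximum over the entries of \<open>A\<close> alone,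
  since every entry of \<open>A\<close> has bitlength at least \<open>2\<close>. For fractional \<open>b\<close> its denominators cannot
  be ignored: the segments \<open>1/3 \<le> x \<le> 1/3 + 1/(3j)\<close> with \<open>j = 3t + 1\<close> all have the matrix with
  entries \<open>1, -1\<close>, but the constituent of \<open>j\<close> is nonzero and vanishes at \<open>j\<close>, so their saturation
  index is at least \<open>j\<close>. The numerators of \<open>b\<close> do not count.\<close>

definition max_bitlength :: "rat mat \<Rightarrow> rat vec \<Rightarrow> nat" where
  "max_bitlength A b =
     Max ({0} \<union> {bitlength_rat (A $$ (i, j)) | i j. i < dim_row A \<and> j < dim_col A}
              \<union> {floorlog 2 (nat (snd (quotient_of (b $ i)))) | i. i < dim_vec b})"

definition polytope_size :: "nat \<Rightarrow> rat mat \<Rightarrow> rat vec \<Rightarrow> nat" where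
  "polytope_size n A b = n + max_bitlength A b"

end

theory Submission
  imports Defs "Jordan_Normal_Form.Determinant" "HOL-Analysis.Function_Topology"
begin

text \<open>Every point of the polytope is a convex combination of basic points, and by Cramer's rule a
  basic point has a denominator that is bounded in terms of the size only, however many
  inequalities there are. The supports of the lexicographically maximal convex combinations form a
  triangulation, so the lattice points of the dilates split into those of open simplices. For an
  open simplex \<open>S\<close> of dimension \<open>d\<close> whose vertices have a common denominator \<open>L\<close>, reducing the
  coefficients to \<open>{0<..L}\<close> shows that the constituents are nonnegative combinations of the
  polynomials \<open>((k - h) / L + d) gchoose d\<close> with \<open>h \<le> (d + 1) * L\<close>. All of these are positive for
  \<open>k > d * L\<close>. The common period plays no role for this bound.\<close>

section \<open>Linear systems\<close>

text \<open>Two quantities must stay independent of the number of inequalities. One is the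
  denominator of a vertex: it comes from \<open>n\<close> independent tight rows, however many are
  tight. The other is the common denominator in the positivity threshold: taken over all vertices it
  could have exponentially many factors, but a simplex has at most \<open>n + 1\<close> vertices, so
  if \<open>M\<close> bounds the denominator of every vertex, \<open>M ^ (n + 1)\<close> suffices.
  Dimension times this number gives the threshold \<open>n * M ^ (n + 1)\<close>. Relatively open
  simplices are disjoint, so their counts add up without signs. With inclusion-exclusion over closed
  simplices the positive terms could cancel and positivity of the summands would say nothing about
  the sum. Lexicographic maximality turns the triangulation into linear algebra: that the simplices
  cover the polytope and are disjoint becomes existence and uniqueness of a representation. The
  definition of constituents also includes \<open>k = 0\<close>, where the polynomial of an open
  simplex differs from its point count; only the sum over all simplices has the right value
  there.\<close>

lemma nontrivial_kernel:
  fixes a :: "nat \<Rightarrow> 'i \<Rightarrow> real"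
  assumes "finite S" "m < card S"
  shows "\<exists>\<kappa>. (\<exists>i\<in>S. \<kappa> i \<noteq> 0) \<and> (\<forall>c<m. (\<Sum>i\<in>S. \<kappa> i * a c i) = 0)"
  using assms
proof (induction m arbitrary: S a)
  case 0
  then show ?case by (intro exI[of _ "\<lambda>_. 1"]) (auto simp: card_gt_0_iff)
next
  case (Suc m)
  show ?case
  proof (cases "\<forall>i\<in>S. a m i = 0")
    case True
    then show ?thesis using Suc.IH[of S a] Suc.prems by (auto simp: less_Suc_eq)
  next
    case False
    then obtain p where p: "p \<in> S" "a m p \<noteq> 0" by auto
    define S' where "S' = S - {p}"
    have S': "finite S'" "m < card S'" "p \<notin> S'" "S = insert p S'"
      using Suc.prems p by (auto simp: S'_def)
    \<comment> \<open>Gaussian elimination: a multiple of equation \<open>m\<close> with pivot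
      \<open>p\<close> is subtracted from the others, which removes the unknown \<open>p\<close>
      from them. The value \<open>q\<close> then solves equation \<open>m\<close> for that
      unknown.\<close>
    obtain \<kappa> i where \<kappa>: "i \<in> S'" "\<kappa> i \<noteq> 0"
      "\<And>c. c < m \<Longrightarrow> (\<Sum>i\<in>S'. \<kappa> i * (a c i - a c p * a m i / a m p)) = 0"
      using Suc.IH[OF S'(1,2), of "\<lambda>c i. a c i - a c p * a m i / a m p"] by auto
    define q where "q = - (\<Sum>i\<in>S'. \<kappa> i * a m i) / a m p"
    have *: "(\<Sum>i\<in>S. (\<kappa>(p := q)) i * a c i) = q * a c p + (\<Sum>i\<in>S'. \<kappa> i * a c i)" for c
    proof -
      have "(\<Sum>i\<in>S'. (\<kappa>(p := q)) i * a c i) = (\<Sum>i\<in>S'. \<kappa> i * a c i)"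
        by (rule sum.cong) (use S' in auto)
      then show ?thesis using S' by simp
    qed
    have "(\<Sum>i\<in>S. (\<kappa>(p := q)) i * a c i) = 0" if "c < Suc m" for c
    proof (cases "c = m")
      case True
      then show ?thesis unfolding * using p by (simp add: q_def)
    next
      case False
      then have "0 = (\<Sum>i\<in>S'. \<kappa> i * (a c i - a c p * a m i / a m p))" using \<kappa>(3) that by simp
      also have "\<dots> = (\<Sum>i\<in>S'. \<kappa> i * a c i) - (\<Sum>i\<in>S'. a c p / a m p * (\<kappa> i * a m i))"
        by (simp add: right_diff_distrib sum_subtractf mult_ac)
      also have "\<dots> = (\<Sum>i\<in>S'. \<kappa> i * a c i) + q * a c p"
        by (simp only: sum_distrib_left[symmetric]) (simp add: q_def)
      finally show ?thesis unfolding * by simp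
    qed
    moreover have "\<exists>i\<in>S. (\<kappa>(p := q)) i \<noteq> 0" using \<kappa> S' by (intro bexI[of _ i]) auto
    ultimately show ?thesis by blast
  qed
qed

text \<open>Says that the rows indexed by \<open>I\<close> have rank \<open>n\<close>. Arbitrary
  index sets are allowed because it is applied to sets of tight constraints.\<close>

definition trivial_kernel :: "nat \<Rightarrow> 'i set \<Rightarrow> ('i \<Rightarrow> nat \<Rightarrow> real) \<Rightarrow> bool" where
  "trivial_kernel n I a \<longleftrightarrow>
     (\<forall>d. (\<forall>i\<in>I. (\<Sum>j<n. a i j * d j) = 0) \<longrightarrow> (\<forall>j<n. d j = 0))"

lemma trivial_kernelD:
  assumes "trivial_kernel n I a" "\<And>i. i \<in> I \<Longrightarrow> (\<Sum>j<n. a i j * d j) = 0" "j < n"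
  shows "d j = 0"
  using assms unfolding trivial_kernel_def by blast

text \<open>An inclusion-minimal set of rows of rank \<open>n\<close> is a basis of the row space.
  This selects a square system from arbitrarily many constraints.\<close>

lemma trivial_kernel_subset_card:
  assumes "finite I" "trivial_kernel n I a"
  obtains J where "J \<subseteq> I" "card J = n" "trivial_kernel n J a"
proof -
  have ex: "\<exists>J. J \<subseteq> I \<and> trivial_kernel n J a" using assms by auto
  obtain J where J: "J \<subseteq> I" "trivial_kernel n J a"
    and min: "\<And>J'. J' \<subseteq> I \<and> trivial_kernel n J' a \<Longrightarrow> card J \<le> card J'"
    using ex_has_least_nat[of "\<lambda>J. J \<subseteq> I \<and> trivial_kernel n J a" _ card] ex by metis
  have fin: "finite J" using J assms finite_subset by blast
  have "n \<le> card J"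
  proof (rule ccontr)
    assume "\<not> n \<le> card J"
    moreover obtain e where e: "bij_betw e {..<card J} J"
      using fin bij_betw_from_nat_into_finite by blast
    ultimately obtain d i where d: "i < n" "d i \<noteq> 0"
        "\<And>c. c < card J \<Longrightarrow> (\<Sum>i<n. d i * a (e c) i) = 0"
      using nontrivial_kernel[of "{..<n}" "card J" "\<lambda>c. a (e c)"] by auto
    have "(\<Sum>j<n. a i j * d j) = 0" if "i \<in> J" for i
      using d(3) that e by (force simp: bij_betw_def mult.commute)
    then show False using J(2) d(1,2) unfolding trivial_kernel_def by blast
  qed
  moreover have "card J \<le> n"
  proof (rule ccontr)
    assume gt: "\<not> card J \<le> n"
    \<comment> \<open>Minimality provides a dual vector for each row \<open>j\<close>: dropping
      \<open>j\<close> enlarges the kernel, and a new kernel vector cannot be orthogonal to row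
      \<open>j\<close>.\<close>
    have "\<exists>d. (\<forall>i\<in>J. i \<noteq> j \<longrightarrow> (\<Sum>l<n. a i l * d l) = 0) \<and> (\<Sum>l<n. a j l * d l) \<noteq> 0"
      if "j \<in> J" for j
    proof -
      have "\<not> trivial_kernel n (J - {j}) a"
        using min[of "J - {j}"] J that fin card_Diff1_less[OF fin that] by (meson Diff_subset leD subset_trans)
      then obtain d l where d: "\<forall>i\<in>J - {j}. (\<Sum>l<n. a i l * d l) = 0" "l < n" "d l \<noteq> 0"
        unfolding trivial_kernel_def by blast
      with J(2) have "(\<Sum>l<n. a j l * d l) \<noteq> 0" unfolding trivial_kernel_def by blast
      with d show ?thesis by blast
    qed
    then obtain d where d: "\<And>i j. i \<in> J \<Longrightarrow> j \<in> J \<Longrightarrow> i \<noteq> j \<Longrightarrow> (\<Sum>l<n. a i l * d j l) = 0"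
      "\<And>j. j \<in> J \<Longrightarrow> (\<Sum>l<n. a j l * d j l) \<noteq> 0" by metis
    \<comment> \<open>More than \<open>n\<close> dual vectors are linearly dependent, but pairing a
      dependence with row \<open>p\<close> leaves only the nonzero term of \<open>p\<close>.\<close>
    obtain \<kappa> p where \<kappa>: "p \<in> J" "\<kappa> p \<noteq> 0" "\<And>c. c < n \<Longrightarrow> (\<Sum>i\<in>J. \<kappa> i * d i c) = 0"
      using nontrivial_kernel[OF fin, of n "\<lambda>c i. d i c"] gt by auto
    have "0 = (\<Sum>l<n. a p l * (\<Sum>i\<in>J. \<kappa> i * d i l))" using \<kappa>(3) by simp
    also have "\<dots> = (\<Sum>l<n. \<Sum>i\<in>J. \<kappa> i * (a p l * d i l))" by (simp add: sum_distrib_left mult_ac)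
    also have "\<dots> = (\<Sum>i\<in>J. \<kappa> i * (\<Sum>l<n. a p l * d i l))"
      by (subst sum.swap) (simp add: sum_distrib_left)
    also have "\<dots> = \<kappa> p * (\<Sum>l<n. a p l * d p l)"
    proof -
      have "(\<Sum>i\<in>J - {p}. \<kappa> i * (\<Sum>l<n. a p l * d i l)) = 0"
        by (rule sum.neutral) (use d(1) \<kappa>(1) in auto)
      then show ?thesis by (simp add: sum.remove[OF fin \<kappa>(1)])
    qed
    finally show False using \<kappa> d(2) by auto
  qed
  ultimately show ?thesis using that J by auto
qed

lemma abs_det_le:
  fixes A :: "int mat"
  assumes A: "A \<in> carrier_mat n n" and M: "\<And>i j. i < n \<Longrightarrow> j < n \<Longrightarrow> \<bar>A $$ (i, j)\<bar> \<le> M"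
  shows "\<bar>det A\<bar> \<le> fact n * M ^ n"
proof -
  have "\<bar>det A\<bar> \<le> (\<Sum>p | p permutes {0..<n}. \<bar>signof p * (\<Prod>i = 0..<n. A $$ (i, p i))\<bar>)"
    unfolding det_def'[OF A] by (rule sum_abs)
  also have "\<dots> \<le> (\<Sum>p | p permutes {0..<n}. M ^ n)"
  proof (rule sum_mono)
    fix p assume "p \<in> {p. p permutes {0..<n}}"
    then have p: "p permutes {0..<n}" by simp
    have "p i < n" if "i < n" for i using permutes_in_image[OF p, of i] that by simp
    then have "(\<Prod>i = 0..<n. \<bar>A $$ (i, p i)\<bar>) \<le> (\<Prod>i = 0..<n. M)"
      by (intro prod_mono conjI M) auto
    then show "\<bar>signof p * (\<Prod>i = 0..<n. A $$ (i, p i))\<bar> \<le> M ^ n"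
      by (simp add: abs_mult abs_prod sign_def)
  qed
  also have "\<dots> = fact n * M ^ n" by (simp add: card_permutations)
  finally show ?thesis .
qed

text \<open>Cramer's rule: the adjugate of \<open>n\<close> independent integral rows is integral,
  so the absolute value of their determinant clears the denominators of \<open>x\<close>. The
  right-hand sides only have to be integers; their size does not enter the bound.\<close>

lemma basic_solution_denominator:
  fixes g :: "'i \<Rightarrow> nat \<Rightarrow> int" and x :: "nat \<Rightarrow> real"
  assumes fin: "finite I" and ker: "trivial_kernel n I (\<lambda>i j. of_int (g i j))"
    and M: "\<And>i j. i \<in> I \<Longrightarrow> j < n \<Longrightarrow> \<bar>g i j\<bar> \<le> M"
    and x: "\<And>i. i \<in> I \<Longrightarrow> (\<Sum>j<n. of_int (g i j) * x j) \<in> \<int>"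
  obtains D :: nat where "D \<ge> 1" "int D \<le> fact n * M ^ n" "\<And>j. j < n \<Longrightarrow> of_nat D * x j \<in> \<int>"
proof -
  obtain J where J: "J \<subseteq> I" "card J = n" "trivial_kernel n J (\<lambda>i j. of_int (g i j))"
    using trivial_kernel_subset_card[OF fin ker] by blast
  have "finite J" using J fin finite_subset by blast
  then obtain e where e: "bij_betw e {..<n} J"
    using bij_betw_from_nat_into_finite J by blast
  have eJ: "e i \<in> J" "e i \<in> I" if "i < n" for i using e J that by (auto simp: bij_betw_def)
  define A where "A = mat n n (\<lambda>(i, j). g (e i) j)"
  have A: "A \<in> carrier_mat n n" by (simp add: A_def)
  have "det A \<noteq> 0"
  proof
    assume "det A = 0"
    then obtain v where v: "v \<in> carrier_vec n" "v \<noteq> 0\<^sub>v n" "A *\<^sub>v v = 0\<^sub>v n"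
      using det_0_iff_vec_prod_zero[OF A] by blast
    have "(\<Sum>j<n. of_int (g i j) * real_of_int (v $ j)) = 0" if "i \<in> J" for i
    proof -
      obtain c where c: "c < n" "i = e c" using \<open>i \<in> J\<close> e by (auto simp: bij_betw_def)
      have "0 = (A *\<^sub>v v) $ c" using v c by simp
      also have "\<dots> = (\<Sum>j<n. g i j * v $ j)"
        using c v(1) by (simp add: A_def scalar_prod_def atLeast0LessThan)
      finally have "real_of_int (\<Sum>j<n. g i j * v $ j) = 0" by simp
      then show ?thesis by simp
    qed
    then have "real_of_int (v $ j) = 0" if "j < n" for j by (rule trivial_kernelD[OF J(3) _ that])
    then have "v $ j = 0\<^sub>v n $ j" if "j < n" for j using that by simp
    then have "v = 0\<^sub>v n" using v(1) by auto
    with v show False by simp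
  qed
  moreover have "of_int (det A) * x j \<in> \<int>" if j: "j < n" for j
  proof -
    have row: "(\<Sum>l<n. adj_mat A $$ (j, l) * g (e l) i) = (if i = j then det A else 0)" if "i < n" for i
    proof -
      have "(adj_mat A * A) $$ (j, i) = (\<Sum>l<n. adj_mat A $$ (j, l) * g (e l) i)"
        using adj_mat(1)[OF A] j that A by (simp add: scalar_prod_def atLeast0LessThan) (simp add: A_def)
      then show ?thesis using adj_mat(3)[OF A] j that by (auto split: if_splits)
    qed
    have "of_int (det A) * x j = (\<Sum>i<n. (if i = j then of_int (det A) * x j else 0))" using j by simp
    also have "\<dots> = (\<Sum>i<n. of_int (\<Sum>l<n. adj_mat A $$ (j, l) * g (e l) i) * x i)"
      by (rule sum.cong) (use row in auto)
    also have "\<dots> = (\<Sum>i<n. \<Sum>l<n. of_int (adj_mat A $$ (j, l)) * (of_int (g (e l) i) * x i))"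
      by (simp add: sum_distrib_right mult.assoc)
    also have "\<dots> = (\<Sum>l<n. of_int (adj_mat A $$ (j, l)) * (\<Sum>i<n. of_int (g (e l) i) * x i))"
      by (subst sum.swap) (simp add: sum_distrib_left)
    also have "\<dots> \<in> \<int>" by (rule Ints_sum, rule Ints_mult) (use x eJ in auto)
    finally show ?thesis .
  qed
  moreover have "\<bar>det A\<bar> \<le> fact n * M ^ n"
    using A by (rule abs_det_le) (use M eJ in \<open>auto simp: A_def\<close>)
  moreover have "real (nat \<bar>det A\<bar>) * x j \<in> \<int> \<longleftrightarrow> of_int (det A) * x j \<in> \<int>" for j
    by (cases "det A \<ge> 0") auto
  ultimately show ?thesis by (intro that[of "nat \<bar>det A\<bar>"]) auto
qed

section \<open>Basic points of polyhedra\<close>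

text \<open>Points are functions on all naturals that vanish from \<open>n\<close> on, so the
  dimension can vary without a type for it and equality of points is equality of functions.\<close>

definition polyhedron :: "nat \<Rightarrow> 'i set \<Rightarrow> ('i \<Rightarrow> nat \<Rightarrow> real) \<Rightarrow> ('i \<Rightarrow> real) \<Rightarrow> (nat \<Rightarrow> real) set" where
  "polyhedron n I a b = {x. (\<forall>j\<ge>n. x j = 0) \<and> (\<forall>i\<in>I. (\<Sum>j<n. a i j * x j) \<le> b i)}"

definition tight :: "nat \<Rightarrow> 'i set \<Rightarrow> ('i \<Rightarrow> nat \<Rightarrow> real) \<Rightarrow> ('i \<Rightarrow> real) \<Rightarrow> (nat \<Rightarrow> real) \<Rightarrow> 'i set" where
  "tight n I a b x = {i \<in> I. (\<Sum>j<n. a i j * x j) = b i}"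

text \<open>These are the vertices: the points whose tight constraints have rank
  \<open>n\<close>.\<close>

definition basic_points :: "nat \<Rightarrow> 'i set \<Rightarrow> ('i \<Rightarrow> nat \<Rightarrow> real) \<Rightarrow> ('i \<Rightarrow> real) \<Rightarrow> (nat \<Rightarrow> real) set" where
  "basic_points n I a b = {x \<in> polyhedron n I a b. trivial_kernel n (tight n I a b x) a}"

text \<open>A vertex is the only solution of its tight equations, hence it is determined by the set
  of its tight constraints.\<close>

lemma finite_basic_points:
  assumes "finite I"
  shows "finite (basic_points n I a b)"
proof (rule inj_on_finite[of "tight n I a b" _ "Pow I"])
  show "inj_on (tight n I a b) (basic_points n I a b)"
  proof (rule inj_onI)
    fix x y assume xy: "x \<in> basic_points n I a b" "y \<in> basic_points n I a b"
      "tight n I a b x = tight n I a b y"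
    have "x j = y j" for j
    proof (cases "j < n")
      case True
      have "x j - y j = 0"
      proof (rule trivial_kernelD[OF _ _ True])
        show "trivial_kernel n (tight n I a b x) a" using xy by (simp add: basic_points_def)
        fix i assume "i \<in> tight n I a b x"
        moreover from this have "i \<in> tight n I a b y" using xy(3) by simp
        ultimately show "(\<Sum>j<n. a i j * (x j - y j)) = 0"
          by (simp add: right_diff_distrib sum_subtractf tight_def)
      qed
      then show ?thesis by simp
    qed (use xy in \<open>auto simp: basic_points_def polyhedron_def\<close>)
    then show "x = y" by blast
  qed
qed (use assms in \<open>auto simp: tight_def\<close>)

text \<open>The ratio test of the simplex method. Moving along \<open>e\<close> keeps the tight
  constraints tight, and boundedness forces a further one to become tight.\<close>

lemma exit_point:
  assumes fin: "finite I" and x: "x \<in> polyhedron n I a b"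
    and bd: "\<forall>y\<in>polyhedron n I a b. \<forall>j<n. \<bar>y j\<bar> \<le> B"
    and e: "\<And>j. j \<ge> n \<Longrightarrow> e j = 0" "p < n" "e p \<noteq> 0"
    and ker: "\<And>i. i \<in> tight n I a b x \<Longrightarrow> (\<Sum>j<n. a i j * e j) = 0"
  obtains t where "t > 0" "(\<lambda>j. x j + t * e j) \<in> polyhedron n I a b"
    "tight n I a b x \<subset> tight n I a b (\<lambda>j. x j + t * e j)"
proof -
  define ax where "ax i = (\<Sum>j<n. a i j * x j)" for i
  define ae where "ae i = (\<Sum>j<n. a i j * e j)" for i
  have lin: "(\<Sum>j<n. a i j * (x j + t * e j)) = ax i + t * ae i" for i t
    by (simp add: ax_def ae_def distrib_left sum.distrib sum_distrib_left mult_ac)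
  have axb: "ax i \<le> b i" if "i \<in> I" for i using x that by (auto simp: polyhedron_def ax_def)
  define K where "K = {i \<in> I. ae i > 0}"
  have "K \<noteq> {}"
  proof
    assume K: "K = {}"
    \<comment> \<open>If no constraint limits the move, this step length pushes coordinate
      \<open>p\<close> beyond the bound \<open>B\<close>.\<close>
    define t where "t = (B + \<bar>x p\<bar> + 1) / \<bar>e p\<bar>"
    have B: "\<bar>x p\<bar> \<le> B" using bd x e(2) by blast
    then have t: "t \<ge> 0" by (simp add: t_def)
    have "ax i + t * ae i \<le> b i" if "i \<in> I" for i
      using K axb[OF that] t mult_nonneg_nonpos[of t "ae i"] that by (fastforce simp: K_def)
    then have "(\<lambda>j. x j + t * e j) \<in> polyhedron n I a b"
      using x e(1) by (auto simp: polyhedron_def lin)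
    with bd e(2) have "\<bar>x p + t * e p\<bar> \<le> B" by fastforce
    moreover have "\<bar>t * e p\<bar> = B + \<bar>x p\<bar> + 1" using e(3) B by (simp add: t_def abs_mult)
    ultimately show False by linarith
  qed
  define t where "t = Min ((\<lambda>i. (b i - ax i) / ae i) ` K)"
  have finK: "finite K" using fin by (simp add: K_def)
  have "t \<in> (\<lambda>i. (b i - ax i) / ae i) ` K"
    unfolding t_def by (rule Min_in) (use finK \<open>K \<noteq> {}\<close> in auto)
  then obtain q where q: "q \<in> K" "t = (b q - ax q) / ae q" by blast
  have tle: "t \<le> (b i - ax i) / ae i" if "i \<in> K" for i
    unfolding t_def using finK that by simp
  \<comment> \<open>\<open>e\<close> annihilates the tight rows, so a row that increases along
    \<open>e\<close> has slack. This makes the minimal ratio positive.\<close>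
  have nt: "ax i < b i" if "i \<in> K" for i
    using axb[of i] ker[of i] that by (force simp: K_def tight_def ax_def ae_def)
  have t: "t > 0" using q nt[of q] by (auto simp: K_def)
  have "ax i + t * ae i \<le> b i" if "i \<in> I" for i
  proof (cases "i \<in> K")
    case True
    then show ?thesis using tle[OF True] by (simp add: K_def field_simps)
  next
    case False
    then show ?thesis using axb[OF that] t that mult_nonneg_nonpos[of t "ae i"] by (force simp: K_def)
  qed
  then have P: "(\<lambda>j. x j + t * e j) \<in> polyhedron n I a b"
    using x e(1) by (auto simp: polyhedron_def lin)
  have "tight n I a b x \<subseteq> tight n I a b (\<lambda>j. x j + t * e j)"
    using ker by (auto simp: tight_def lin) (auto simp: ax_def ae_def)
  moreover have "q \<in> tight n I a b (\<lambda>j. x j + t * e j)"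
    using q(1) unfolding tight_def lin by (auto simp: K_def q(2))
  moreover have "q \<notin> tight n I a b x" using nt[OF q(1)] by (auto simp: tight_def ax_def)
  ultimately show ?thesis using that[OF t P] by blast
qed

text \<open>Induction on the number of constraints that are not tight: a point that is no vertex
  lies on a segment between two exit points in opposite directions, and each of these has more tight
  constraints.\<close>

lemma convex_combination_basic_points:
  assumes fin: "finite I"
    and bd: "\<forall>y\<in>polyhedron n I a b. \<forall>j<n. \<bar>y j\<bar> \<le> B"
    and x: "x \<in> polyhedron n I a b"
  shows "\<exists>\<mu>. (\<forall>w\<in>basic_points n I a b. \<mu> w \<ge> 0) \<and> (\<Sum>w\<in>basic_points n I a b. \<mu> w) = 1 \<and>
    (\<forall>j. x j = (\<Sum>w\<in>basic_points n I a b. \<mu> w * w j))"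
  using x
proof (induction "card (I - tight n I a b x)" arbitrary: x rule: less_induct)
  case less
  let ?V = "basic_points n I a b"
  have finV: "finite ?V" using fin by (rule finite_basic_points)
  show ?case
  proof (cases "x \<in> ?V")
    case True
    have "(if w = x then 1 else 0) * w j = (if w = x then x j else 0)" for w :: "nat \<Rightarrow> real" and j
      by simp
    then show ?thesis using finV True by (intro exI[of _ "\<lambda>w. if w = x then 1 else 0"]) auto
  next
    case False
    then have "\<not> trivial_kernel n (tight n I a b x) a" using less.prems by (simp add: basic_points_def)
    then obtain d0 p where d0: "\<And>i. i \<in> tight n I a b x \<Longrightarrow> (\<Sum>j<n. a i j * d0 j) = 0" "p < n" "d0 p \<noteq> 0"
      unfolding trivial_kernel_def by blast
    define d where "d j = (if j < n then d0 j else 0)" for j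
    have d: "(\<Sum>j<n. a i j * d j) = 0" if "i \<in> tight n I a b x" for i
      using d0(1)[OF that] by (simp add: d_def)
    have IH: "\<exists>\<mu>. (\<forall>w\<in>?V. \<mu> w \<ge> 0) \<and> (\<Sum>w\<in>?V. \<mu> w) = 1 \<and> (\<forall>j. y j = (\<Sum>w\<in>?V. \<mu> w * w j))"
      if "y \<in> polyhedron n I a b" "tight n I a b x \<subset> tight n I a b y" for y
    proof (rule less.hyps)
      have "tight n I a b y \<subseteq> I" by (auto simp: tight_def)
      then have "I - tight n I a b y \<subset> I - tight n I a b x" using that(2) by blast
      then show "card (I - tight n I a b y) < card (I - tight n I a b x)"
        using fin by (intro psubset_card_mono) auto
    qed (fact that)
    obtain t where t: "t > 0" "(\<lambda>j. x j + t * d j) \<in> polyhedron n I a b"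
        "tight n I a b x \<subset> tight n I a b (\<lambda>j. x j + t * d j)"
      by (rule exit_point[OF fin less.prems bd, of d p]) (use d d0 in \<open>auto simp: d_def\<close>)
    obtain s where s: "s > 0" "(\<lambda>j. x j + s * (- d j)) \<in> polyhedron n I a b"
        "tight n I a b x \<subset> tight n I a b (\<lambda>j. x j + s * (- d j))"
    proof (rule exit_point[OF fin less.prems bd, of "\<lambda>j. - d j" p])
      show "(\<Sum>j<n. a i j * - d j) = 0" if "i \<in> tight n I a b x" for i
        using d[OF that] by (simp add: sum_negf)
    qed (use d0 in \<open>auto simp: d_def\<close>)
    obtain \<mu> where \<mu>: "\<forall>w\<in>?V. \<mu> w \<ge> 0" "(\<Sum>w\<in>?V. \<mu> w) = 1"
        "\<And>j. x j + t * d j = (\<Sum>w\<in>?V. \<mu> w * w j)"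
      using IH[OF t(2,3)] by auto
    obtain \<nu> where \<nu>: "\<forall>w\<in>?V. \<nu> w \<ge> 0" "(\<Sum>w\<in>?V. \<nu> w) = 1"
        "\<And>j. x j + s * - d j = (\<Sum>w\<in>?V. \<nu> w * w j)"
      using IH[OF s(2,3)] by auto
    \<comment> \<open>Each end is weighted by the step length of the other, so that the
      displacements along \<open>d\<close> cancel.\<close>
    define \<alpha> where "\<alpha> = s / (s + t)"
    define \<beta> where "\<beta> = t / (s + t)"
    have ab: "\<alpha> \<ge> 0" "\<beta> \<ge> 0" "\<alpha> + \<beta> = 1" "\<alpha> * t = \<beta> * s"
      using s t by (auto simp: \<alpha>_def \<beta>_def add_divide_distrib[symmetric])
    have comb: "(\<Sum>w\<in>?V. (\<alpha> * \<mu> w + \<beta> * \<nu> w) * g w) = \<alpha> * (\<Sum>w\<in>?V. \<mu> w * g w) + \<beta> * (\<Sum>w\<in>?V. \<nu> w * g w)" for g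
      by (simp add: distrib_right sum.distrib sum_distrib_left mult.assoc)
    have "x j = (\<Sum>w\<in>?V. (\<alpha> * \<mu> w + \<beta> * \<nu> w) * w j)" for j
    proof -
      have "(\<Sum>w\<in>?V. (\<alpha> * \<mu> w + \<beta> * \<nu> w) * w j) = \<alpha> * (x j + t * d j) + \<beta> * (x j + s * - d j)"
        unfolding comb \<mu>(3) \<nu>(3) ..
      also have "\<dots> = (\<alpha> + \<beta>) * x j + (\<alpha> * t - \<beta> * s) * d j" by (simp add: algebra_simps)
      finally show ?thesis using ab by simp
    qed
    moreover have "(\<Sum>w\<in>?V. \<alpha> * \<mu> w + \<beta> * \<nu> w) = 1"
      using comb[of "\<lambda>_. 1"] \<mu>(2) \<nu>(2) ab by simp
    ultimately show ?thesis using \<mu>(1) \<nu>(1) ab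
      by (intro exI[of _ "\<lambda>w. \<alpha> * \<mu> w + \<beta> * \<nu> w"]) auto
  qed
qed

section \<open>Pulling triangulations\<close>

definition lex_pos :: "nat \<Rightarrow> (nat \<Rightarrow> real) \<Rightarrow> bool" where
  "lex_pos r \<kappa> \<longleftrightarrow> (\<exists>i<r. \<kappa> i > 0 \<and> (\<forall>j<i. \<kappa> j = 0))"

lemma lex_pos_cases:
  assumes "i < r" "\<kappa> i \<noteq> 0"
  shows "lex_pos r \<kappa> \<or> lex_pos r (\<lambda>i. - \<kappa> i)"
proof -
  define m where "m = (LEAST i. \<kappa> i \<noteq> 0)"
  have "\<kappa> m \<noteq> 0" unfolding m_def using assms(2) by (rule LeastI)
  moreover have "m \<le> i" unfolding m_def using assms(2) by (rule Least_le)
  moreover have "\<kappa> j = 0" if "j < m" for j using not_less_Least that unfolding m_def by blast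
  ultimately show ?thesis using assms(1) unfolding lex_pos_def
    by (cases "\<kappa> m > 0") (auto intro!: exI[of _ m])
qed

text \<open>The lexicographic order is not given by one continuous function, so the coordinates are
  maximised one after another on shrinking nonempty compact sets.\<close>

lemma compact_lex_max:
  fixes K :: "(nat \<Rightarrow> real) set"
  assumes "compact K" "K \<noteq> {}"
  obtains x where "x \<in> K" "\<And>y. y \<in> K \<Longrightarrow> \<not> lex_pos r (\<lambda>i. y i - x i)"
proof -
  \<comment> \<open>The closure condition in the second line carries the induction: a competitor
    from \<open>K\<close> that agrees with a point of \<open>K'\<close> in the first
    \<open>r\<close> coordinates lies in \<open>K'\<close> itself and is therefore compared when
    coordinate \<open>r\<close> is maximised.\<close>
  have "\<exists>K'. compact K' \<and> K' \<noteq> {} \<and> K' \<subseteq> K \<and>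
      (\<forall>x\<in>K'. \<forall>y\<in>K. (\<forall>j<r. y j = x j) \<longrightarrow> y \<in> K') \<and>
      (\<forall>x\<in>K'. \<forall>y\<in>K. \<forall>i<r. (\<forall>j<i. y j = x j) \<longrightarrow> y i \<le> x i)" for r
  proof (induction r)
    case 0
    then show ?case using assms by (intro exI[of _ K]) auto
  next
    case (Suc r)
    then obtain K' where K': "compact K'" "K' \<noteq> {}" "K' \<subseteq> K"
      and cl: "\<forall>x\<in>K'. \<forall>y\<in>K. (\<forall>j<r. y j = x j) \<longrightarrow> y \<in> K'"
      and mx: "\<forall>x\<in>K'. \<forall>y\<in>K. \<forall>i<r. (\<forall>j<i. y j = x j) \<longrightarrow> y i \<le> x i"
      by (elim exE conjE)
    have "continuous_on K' (\<lambda>x. x r)"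
      by (rule continuous_on_subset[OF continuous_on_product_coordinates subset_UNIV])
    then obtain z where z: "z \<in> K'" "\<And>y. y \<in> K' \<Longrightarrow> y r \<le> z r"
      using continuous_attains_sup[OF K'(1,2), of "\<lambda>x. x r"] by blast
    let ?K = "K' \<inter> {x. x r = z r}"
    have "closed {x :: nat \<Rightarrow> real. x r = z r}"
      by (intro closed_Collect_eq continuous_on_product_coordinates continuous_on_const)
    then have "compact ?K" using K' by (intro compact_Int_closed)
    moreover have "y i \<le> x i" if "x \<in> ?K" "y \<in> K" "i < Suc r" "\<forall>j<i. y j = x j" for x y i
    proof (cases "i = r")
      case True
      then have "y \<in> K'" using bspec[OF bspec[OF cl, of x], of y] that by simp
      then show ?thesis using z that True by auto
    qed (use bspec[OF bspec[OF mx, of x], of y] that in simp)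
    moreover have "y \<in> ?K" if "x \<in> ?K" "y \<in> K" "\<forall>j<Suc r. y j = x j" for x y
      using bspec[OF bspec[OF cl, of x], of y] that by simp
    ultimately show ?case using z K'(3) by (intro exI[of _ ?K] conjI ballI allI impI) auto
  qed
  from this[of r] obtain K' where K': "K' \<noteq> {}" "K' \<subseteq> K"
    and mx: "\<forall>x\<in>K'. \<forall>y\<in>K. \<forall>i<r. (\<forall>j<i. y j = x j) \<longrightarrow> y i \<le> x i"
    by (elim exE conjE)
  then obtain x where x: "x \<in> K'" by blast
  have "\<not> lex_pos r (\<lambda>i. y i - x i)" if "y \<in> K" for y
  proof
    assume "lex_pos r (\<lambda>i. y i - x i)"
    then obtain i where "i < r" "y i > x i" "\<forall>j<i. y j = x j" unfolding lex_pos_def by auto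
    with mx x that show False by (meson not_less)
  qed
  then show ?thesis using that x K' by blast
qed

locale point_configuration =
  fixes n r :: nat and v :: "nat \<Rightarrow> nat \<Rightarrow> real"
begin

definition affine_dependence :: "(nat \<Rightarrow> real) \<Rightarrow> bool" where
  "affine_dependence \<kappa> \<longleftrightarrow> (\<Sum>i<r. \<kappa> i) = 0 \<and> (\<forall>c<n. (\<Sum>i<r. \<kappa> i * v i c) = 0)"

text \<open>The faces of the pulling triangulation: the supports of the lexicographically maximal
  representations of the points of the convex hull.\<close>

definition faces :: "nat set set" where
  "faces = {S. S \<subseteq> {..<r} \<and>
     \<not> (\<exists>\<kappa>. affine_dependence \<kappa> \<and> lex_pos r \<kappa> \<and> (\<forall>i<r. i \<notin> S \<longrightarrow> \<kappa> i \<ge> 0))}"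

lemma finite_faces: "finite faces"
  by (rule finite_subset[of _ "Pow {..<r}"]) (auto simp: faces_def)

lemma face_subset: "S \<in> faces \<Longrightarrow> S \<subseteq> {..<r}"
  by (simp add: faces_def)

lemma face_finite: "S \<in> faces \<Longrightarrow> finite S"
  using face_subset finite_subset by blast

lemma facesD:
  "S \<in> faces \<Longrightarrow> affine_dependence \<kappa> \<Longrightarrow> lex_pos r \<kappa> \<Longrightarrow> \<exists>i<r. i \<notin> S \<and> \<kappa> i < 0"
  by (force simp: faces_def)

lemma facesI:
  assumes "S \<subseteq> {..<r}"
    and "\<And>\<kappa>. affine_dependence \<kappa> \<Longrightarrow> lex_pos r \<kappa> \<Longrightarrow> \<exists>i<r. i \<notin> S \<and> \<kappa> i < 0"
  shows "S \<in> faces"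
  using assms unfolding faces_def by (simp, meson not_less)

lemma affine_dependence_minus:
  "affine_dependence \<kappa> \<Longrightarrow> affine_dependence (\<lambda>i. - \<kappa> i)"
  by (simp add: affine_dependence_def sum_negf)

lemma affine_dependence_diff:
  assumes "(\<Sum>i<r. x i) = (\<Sum>i<r. y i)" "\<And>c. c < n \<Longrightarrow> (\<Sum>i<r. x i * v i c) = (\<Sum>i<r. y i * v i c)"
  shows "affine_dependence (\<lambda>i. x i - y i)"
  using assms by (simp add: affine_dependence_def sum_subtractf left_diff_distrib)

text \<open>One of \<kappa> and its negative is lexicographically positive, and neither has a
  negative entry outside \<open>S\<close>. Hence the points indexed by a face are affinely
  independent and span a simplex.\<close>

lemma face_independent:
  assumes "S \<in> faces" "affine_dependence \<kappa>" "\<And>i. i < r \<Longrightarrow> i \<notin> S \<Longrightarrow> \<kappa> i = 0" "i < r"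
  shows "\<kappa> i = 0"
proof (rule ccontr)
  assume "\<kappa> i \<noteq> 0"
  then consider "lex_pos r \<kappa>" | "lex_pos r (\<lambda>i. - \<kappa> i)" using lex_pos_cases assms(4) by blast
  then show False
    using facesD[OF assms(1)] assms(2,3) affine_dependence_minus[OF assms(2)] by cases force+
qed

lemma card_face_le:
  assumes S: "S \<in> faces"
  shows "card S \<le> n + 1"
proof (rule ccontr)
  assume "\<not> card S \<le> n + 1"
  \<comment> \<open>Homogenisation: equation \<open>n\<close> has all coefficients \<open>1\<close>
    and encodes that the coefficients sum to zero.\<close>
  then obtain \<kappa> p where \<kappa>: "p \<in> S" "\<kappa> p \<noteq> 0"
      "\<And>c. c < n + 1 \<Longrightarrow> (\<Sum>i\<in>S. \<kappa> i * (if c < n then v i c else 1)) = 0"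
    using nontrivial_kernel[OF face_finite[OF S], of "n + 1" "\<lambda>c i. if c < n then v i c else 1"]
    by auto
  define \<kappa>' where "\<kappa>' i = (if i \<in> S then \<kappa> i else 0)" for i
  have sub: "S \<subseteq> {..<r}" using S by (rule face_subset)
  have eq: "(\<Sum>i<r. \<kappa>' i * g i) = (\<Sum>i\<in>S. \<kappa> i * g i)" for g
    by (rule sum.mono_neutral_cong_right) (use sub in \<open>auto simp: \<kappa>'_def\<close>)
  have "affine_dependence \<kappa>'"
    unfolding affine_dependence_def
  proof (intro conjI allI impI)
    show "(\<Sum>i<r. \<kappa>' i) = 0" using eq[of "\<lambda>_. 1"] \<kappa>(3)[of n] by simp
    show "(\<Sum>i<r. \<kappa>' i * v i c) = 0" if "c < n" for c using eq[of "\<lambda>i. v i c"] \<kappa>(3)[of c] that by simp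
  qed
  then have "\<kappa>' p = 0" by (rule face_independent[OF S]) (use \<kappa> sub in \<open>auto simp: \<kappa>'_def\<close>)
  then show False using \<kappa> by (simp add: \<kappa>'_def)
qed

text \<open>The difference of two representations is an affine dependence. Oriented so that it is
  lexicographically positive, it can be negative only on the support of the smaller representation,
  which a face forbids.\<close>

lemma unique_face_representation:
  assumes nn: "\<And>i. i < r \<Longrightarrow> x i \<ge> 0" "\<And>i. i < r \<Longrightarrow> y i \<ge> 0"
    and supp: "{i. i < r \<and> x i \<noteq> 0} \<in> faces" "{i. i < r \<and> y i \<noteq> 0} \<in> faces"
    and eq: "(\<Sum>i<r. x i) = (\<Sum>i<r. y i)" "\<And>c. c < n \<Longrightarrow> (\<Sum>i<r. x i * v i c) = (\<Sum>i<r. y i * v i c)"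
    and i: "i < r"
  shows "x i = y i"
proof (rule ccontr)
  assume "x i \<noteq> y i"
  then have "lex_pos r (\<lambda>i. x i - y i) \<or> lex_pos r (\<lambda>i. y i - x i)"
    using lex_pos_cases[OF i, of "\<lambda>i. x i - y i"] by auto
  then show False
  proof
    assume "lex_pos r (\<lambda>i. x i - y i)"
    then show False
      using facesD[OF supp(2) affine_dependence_diff[OF eq]] nn by force
  next
    assume "lex_pos r (\<lambda>i. y i - x i)"
    then show False
      using facesD[OF supp(1) affine_dependence_diff[OF eq[symmetric]]] nn by force
  qed
qed

text \<open>The lexicographically largest representation works: if its support were not a face,
  adding a small multiple of the violating dependence would give a larger one.\<close>

lemma exists_face_representation:
  assumes nn: "\<forall>i<r. x i \<ge> 0"
  shows "\<exists>y. (\<forall>i. y i \<ge> 0) \<and> (\<forall>i\<ge>r. y i = 0) \<and> {i. i < r \<and> y i \<noteq> 0} \<in> faces \<and>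
    (\<Sum>i<r. y i) = (\<Sum>i<r. x i) \<and> (\<forall>c<n. (\<Sum>i<r. y i * v i c) = (\<Sum>i<r. x i * v i c))"
proof -
  define K where "K = {y. (\<forall>i. y i \<ge> 0) \<and> (\<forall>i\<ge>r. y i = 0) \<and> (\<Sum>i<r. y i) = (\<Sum>i<r. x i) \<and>
    (\<forall>c<n. (\<Sum>i<r. y i * v i c) = (\<Sum>i<r. x i * v i c))}"
  define X where "X = (\<Sum>i<r. x i)"
  have "X \<ge> 0" unfolding X_def using nn by (intro sum_nonneg) auto
  \<comment> \<open>Tychonoff for a cube: nonnegative coefficients with sum \<open>X\<close> lie
    between \<open>0\<close> and \<open>X\<close>.\<close>
  have "compact (PiE UNIV (\<lambda>_ :: nat. {0..X}))"
    using compactin_PiE[of "\<lambda>_ :: nat. euclidean :: real topology" UNIV "\<lambda>_. {0..X}"]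
    by (simp add: euclidean_product_topology compactin_euclidean_iff)
  moreover have "closed K"
    unfolding K_def
    by (intro closed_Collect_conj closed_Collect_all closed_Collect_imp open_Collect_const
          closed_Collect_eq closed_Collect_le continuous_intros continuous_on_product_coordinates)
  moreover have "K \<subseteq> PiE UNIV (\<lambda>_ :: nat. {0..X})"
  proof
    fix y assume y: "y \<in> K"
    have "y i \<le> X" for i
    proof (cases "i < r")
      case True
      then have "y i \<le> (\<Sum>i<r. y i)" using y by (intro member_le_sum) (auto simp: K_def)
      then show ?thesis using y by (simp add: K_def X_def)
    qed (use y \<open>X \<ge> 0\<close> in \<open>auto simp: K_def\<close>)
    then show "y \<in> PiE UNIV (\<lambda>_. {0..X})" using y by (auto simp: K_def)
  qed
  ultimately have "compact K" by (metis compact_Int_closed inf.absorb_iff2)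
  moreover have "(\<lambda>i. if i < r then x i else 0) \<in> K" using nn by (auto simp: K_def)
  ultimately obtain y where y: "y \<in> K" and mx: "\<And>z. z \<in> K \<Longrightarrow> \<not> lex_pos r (\<lambda>i. z i - y i)"
    using compact_lex_max[of K r] by blast
  have "{i. i < r \<and> y i \<noteq> 0} \<in> faces"
  proof (rule ccontr)
    assume "{i. i < r \<and> y i \<noteq> 0} \<notin> faces"
    then obtain \<kappa> where \<kappa>: "affine_dependence \<kappa>" "lex_pos r \<kappa>" "\<And>i. i < r \<Longrightarrow> y i = 0 \<Longrightarrow> \<kappa> i \<ge> 0"
      by (auto simp: faces_def)
    \<comment> \<open>A step that keeps every positive coefficient nonnegative. The summand
      \<open>1\<close> in the denominators avoids division by zero, and the inserted
      \<open>1\<close> keeps the minimum defined when the support is empty.\<close>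
    define \<epsilon> where "\<epsilon> = Min (insert 1 ((\<lambda>i. y i / (1 + \<bar>\<kappa> i\<bar>)) ` {i. i < r \<and> y i \<noteq> 0}))"
    have "y i > 0" if "y i \<noteq> 0" for i using y that by (auto simp: K_def order_less_le)
    then have \<epsilon>: "\<epsilon> > 0" unfolding \<epsilon>_def by (subst Min_gr_iff) auto
    have nonneg: "y i + \<epsilon> * \<kappa> i \<ge> 0" if "i < r" for i
    proof (cases "y i = 0")
      case True
      then show ?thesis using \<kappa>(3) that \<epsilon> by simp
    next
      case False
      have "\<epsilon> \<le> y i / (1 + \<bar>\<kappa> i\<bar>)" unfolding \<epsilon>_def using that False by (intro Min_le) auto
      then have "\<epsilon> * (1 + \<bar>\<kappa> i\<bar>) \<le> y i" by (simp add: field_simps)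
      moreover have "\<epsilon> * (- \<kappa> i) \<le> \<epsilon> * (1 + \<bar>\<kappa> i\<bar>)" using \<epsilon> by (intro mult_left_mono) auto
      ultimately show ?thesis by simp
    qed
    define z where "z i = (if i < r then y i + \<epsilon> * \<kappa> i else 0)" for i
    have sums: "(\<Sum>i<r. z i * g i) = (\<Sum>i<r. y i * g i) + \<epsilon> * (\<Sum>i<r. \<kappa> i * g i)" for g
      by (simp add: z_def distrib_right sum.distrib sum_distrib_left mult.assoc)
    have "(\<Sum>i<r. z i) = (\<Sum>i<r. y i)" "\<And>c. c < n \<Longrightarrow> (\<Sum>i<r. z i * v i c) = (\<Sum>i<r. y i * v i c)"
      using sums[of "\<lambda>_. 1"] \<kappa>(1) by (simp_all add: sums affine_dependence_def)
    moreover have "z i \<ge> 0" "i \<ge> r \<Longrightarrow> z i = 0" for i using nonneg by (auto simp: z_def)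
    ultimately have "z \<in> K" using y unfolding K_def by simp
    moreover have "lex_pos r (\<lambda>i. z i - y i)"
    proof -
      obtain i where "i < r" "\<kappa> i > 0" "\<forall>j<i. \<kappa> j = 0" using \<kappa>(2) unfolding lex_pos_def by blast
      then show ?thesis unfolding lex_pos_def z_def using \<epsilon> by (intro exI[of _ i]) auto
    qed
    ultimately show False using mx by blast
  qed
  then show ?thesis using y by (intro exI[of _ y]) (auto simp: K_def)
qed

text \<open>Adding or removing the point with index \<open>0\<close> is an involution on the faces.\<close>

lemma faces_alternating_sum:
  assumes r: "r > 0"
  shows "(\<Sum>S\<in>faces. (- 1 :: real) ^ card S) = 0"
proof -
  define i where "i S = (if 0 \<in> S then S - {0} else insert 0 S)" for S :: "nat set"
  have ins: "insert 0 S \<in> faces" if S: "S \<in> faces" for S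
  proof -
    have "\<exists>i<r. i \<notin> insert 0 S \<and> \<kappa> i < 0" if \<kappa>: "affine_dependence \<kappa>" "lex_pos r \<kappa>" for \<kappa>
    proof -
      \<comment> \<open>A lexicographically positive vector is nonnegative at its first index, so
        the negative entry witnessing the face condition never has index \<open>0\<close>. This is
        why membership of \<open>0\<close> can be toggled.\<close>
      have "\<kappa> 0 \<ge> 0" using \<kappa>(2) unfolding lex_pos_def by (metis gr0I less_eq_real_def)
      moreover obtain i where "i < r" "i \<notin> S" "\<kappa> i < 0" using facesD[OF S \<kappa>] by blast
      ultimately show ?thesis by (intro exI[of _ i]) (auto intro: gr0I)
    qed
    then show ?thesis using face_subset[OF S] r by (intro facesI) auto
  qed
  moreover have "S - {0} \<in> faces" if "S \<in> faces" for S
    by (rule facesI) (use face_subset[OF that] facesD[OF that] in blast)+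
  ultimately have i: "i S \<in> faces" if "S \<in> faces" for S using that by (simp add: i_def)
  have "(\<Sum>S\<in>faces. (- 1 :: real) ^ card S) = (\<Sum>S\<in>faces. - ((- 1) ^ card S))"
  proof (rule sum.reindex_bij_witness[of _ i i])
    fix S assume S: "S \<in> faces"
    show "i (i S) = S" by (auto simp: i_def)
    show "- ((- 1) ^ card (i S)) = (- 1 :: real) ^ card S"
    proof -
      have "card S = Suc (card (i S)) \<or> card (i S) = Suc (card S)"
        using card_Suc_Diff1[OF face_finite[OF S], of 0] face_finite[OF S] by (auto simp: i_def)
      then show ?thesis by auto
    qed
  qed (use i in \<open>auto simp: i_def\<close>)
  then show ?thesis by (simp add: sum_negf)
qed

end

section \<open>Lattice points of dilates\<close>

text \<open>Stars and bars, by the hockey-stick identity. For empty \<open>S\<close> the truncated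
  \<open>card S - 1\<close> would give the count \<open>1\<close> for every \<open>m\<close>, hence
  the guard; finiteness is carried along because the induction sums cardinalities.\<close>

lemma card_compositions:
  assumes "finite S"
  shows "finite {t :: 'i \<Rightarrow> nat. (\<forall>i. i \<notin> S \<longrightarrow> t i = 0) \<and> (\<Sum>i\<in>S. t i) = m} \<and>
    (S \<noteq> {} \<longrightarrow> card {t :: 'i \<Rightarrow> nat. (\<forall>i. i \<notin> S \<longrightarrow> t i = 0) \<and> (\<Sum>i\<in>S. t i) = m}
      = (m + (card S - 1)) choose (card S - 1))"
  using assms
proof (induction S arbitrary: m rule: finite_induct)
  case empty
  have "{t :: 'i \<Rightarrow> nat. \<forall>i. t i = 0} = {\<lambda>_. 0}" by auto
  then show ?case by (simp add: finite_subset[of _ "{\<lambda>_. 0}"])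
next
  case (insert a S)
  let ?C = "\<lambda>S m. {t :: 'i \<Rightarrow> nat. (\<forall>i. i \<notin> S \<longrightarrow> t i = 0) \<and> (\<Sum>i\<in>S. t i) = m}"
  have upd: "(\<Sum>i\<in>S. (t(a := x)) i) = (\<Sum>i\<in>S. t i)" for t :: "'i \<Rightarrow> nat" and x
    by (rule sum.cong) (use insert.hyps in auto)
  \<comment> \<open>\<open>j\<close> is the sum that remains for \<open>S\<close> after the new
    index \<open>a\<close> has taken \<open>m - j\<close>.\<close>
  have bij: "bij_betw (\<lambda>(j, t). t(a := m - j)) (SIGMA j:{..m}. ?C S j) (?C (insert a S) m)"
  proof (rule bij_betw_byWitness[where f' = "\<lambda>t. (m - t a, t(a := 0))"], goal_cases)
    case 1
    then show ?case using insert.hyps by (auto simp: fun_eq_iff)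
  next
    case 2
    then show ?case using insert.hyps by (auto simp: fun_eq_iff)
  next
    case 3
    then show ?case using insert.hyps upd by auto
  next
    case 4
    then show ?case using insert.hyps upd by auto
  qed
  have fin: "finite (SIGMA j:{..m}. ?C S j)" using insert.IH by auto
  have "card (?C (insert a S) m) = (m + card S) choose card S"
  proof (cases "S = {}")
    case True
    have "?C {} j = (if j = 0 then {\<lambda>_. 0} else {})" for j by (auto simp: fun_eq_iff)
    then have "(SIGMA j:{..m}. ?C S j) = {(0, \<lambda>_. 0)}" using True by (auto split: if_splits)
    then show ?thesis using bij_betw_same_card[OF bij] True by simp
  next
    case False
    then have c: "card S \<ge> 1" using insert.hyps by (simp add: Suc_le_eq card_gt_0_iff)
    have "card (?C (insert a S) m) = card (SIGMA j:{..m}. ?C S j)"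
      using bij_betw_same_card[OF bij] by simp
    also have "\<dots> = (\<Sum>j\<le>m. card (?C S j))" using insert.IH by (intro card_SigmaI) auto
    also have "\<dots> = (\<Sum>j\<le>m. ((card S - 1) + j) choose (card S - 1))"
      using insert.IH False by (intro sum.cong) (auto simp: add.commute)
    also have "\<dots> = (m + card S) choose card S"
      using choose_rising_sum(1)[of "card S - 1" m] c by (simp add: add.commute)
    finally show ?thesis .
  qed
  then show ?case using bij_betw_finite[OF bij] fin insert.hyps by simp
qed

section \<open>Binomial polynomials in the dilation factor\<close>

definition shifted_binomial :: "nat \<Rightarrow> nat \<Rightarrow> nat \<Rightarrow> real poly" where
  "shifted_binomial d L h = smult (1 / fact d) (\<Prod>j = 0..<d. [:1 + real j - real h / real L, 1 / real L:])"

text \<open>The rising factorial makes the sign and the zeros visible: the smallest factor decides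
  positivity, and the zeros are the points \<open>h - L * m\<close> with \<open>m\<close> between
  \<open>1\<close> and \<open>d\<close>.\<close>

lemma poly_shifted_binomial:
  "poly (shifted_binomial d L h) x = pochhammer ((x - real h) / real L + 1) d / fact d"
  by (simp add: shifted_binomial_def poly_prod pochhammer_prod diff_divide_distrib algebra_simps)

lemma poly_shifted_binomial_pos:
  assumes "L > 0" "x > real h - real L"
  shows "poly (shifted_binomial d L h) x > 0"
  unfolding poly_shifted_binomial using assms
  by (intro divide_pos_pos pochhammer_pos) (auto simp: field_simps)

lemma poly_shifted_binomial_choose:
  assumes "L > 0"
  shows "poly (shifted_binomial d L h) (real (h + L * m)) = real ((m + d) choose d)"
  unfolding poly_shifted_binomial binomial_gbinomial gbinomial_pochhammer' using assms
  by (simp add: field_simps)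

text \<open>Allows heights \<open>h\<close> above \<open>k\<close> to stay in the sum for a
  constituent: they are congruent to \<open>k\<close> but contribute nothing.\<close>

lemma poly_shifted_binomial_eq_0:
  assumes "L > 0" "h = k + L * m" "1 \<le> m" "m \<le> d"
  shows "poly (shifted_binomial d L h) (real k) = 0"
proof -
  have "(real k - real h) / real L + 1 = - real (m - 1)" using assms by (simp add: field_simps)
  then have "pochhammer ((real k - real h) / real L + 1) d = 0"
    unfolding pochhammer_eq_0_iff using assms by (intro exI[of _ "m - 1"]) auto
  then show ?thesis by (simp add: poly_shifted_binomial)
qed

text \<open>The height \<open>Suc d * L\<close> is the first multiple of \<open>L\<close> above the
  heights \<open>L * m\<close> with \<open>m\<close> between \<open>1\<close> and \<open>d\<close>,
  at which the value at \<open>0\<close> vanishes; it supplies the sign of a simplex at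
  \<open>k = 0\<close>.\<close>

lemma poly_shifted_binomial_0:
  assumes "L > 0"
  shows "poly (shifted_binomial d L (Suc d * L)) 0 = (- 1) ^ d"
proof -
  have "(0 - real (Suc d * L)) / real L + 1 = - real d" using assms by (simp add: field_simps)
  then show ?thesis by (simp add: poly_shifted_binomial pochhammer_same)
qed

section \<open>Splitting the lattice points among the open simplices\<close>

context point_configuration
begin

text \<open>The dilation is put into the coefficient sum and not into the points \<open>v\<close>,
  so the integrality of the vertices after scaling by their denominators can be used
  directly.\<close>

definition dilate_points :: "nat \<Rightarrow> (nat \<Rightarrow> real) set" where
  "dilate_points k = {z. (\<forall>c\<ge>n. z c = 0) \<and> (\<forall>c<n. z c \<in> \<int>) \<and>
     (\<exists>x. (\<forall>i<r. x i \<ge> 0) \<and> (\<Sum>i<r. x i) = real k \<and> (\<forall>c<n. z c = (\<Sum>i<r. x i * v i c)))}"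

text \<open>Scaled barycentric coordinates of the lattice points in one dilated open simplex; strict
  positivity on \<open>S\<close> is what makes the simplex open.\<close>

definition weights :: "nat set \<Rightarrow> nat \<Rightarrow> (nat \<Rightarrow> real) set" where
  "weights S k = {x. (\<forall>i\<in>S. x i > 0) \<and> (\<forall>i. i \<notin> S \<longrightarrow> x i = 0) \<and> (\<Sum>i\<in>S. x i) = real k \<and>
     (\<forall>c<n. (\<Sum>i\<in>S. x i * v i c) \<in> \<int>)}"

definition combination :: "(nat \<Rightarrow> real) \<Rightarrow> nat \<Rightarrow> real" where
  "combination x c = (if c < n then \<Sum>i<r. x i * v i c else 0)"

lemma sum_face:
  fixes x g :: "nat \<Rightarrow> real"
  assumes "S \<in> faces" "\<And>i. i \<notin> S \<Longrightarrow> x i = 0"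
  shows "(\<Sum>i<r. x i * g i) = (\<Sum>i\<in>S. x i * g i)"
  by (rule sum.mono_neutral_right) (use face_subset[OF assms(1)] assms(2) in auto)

lemma weights_support:
  assumes "S \<in> faces" "x \<in> weights S k"
  shows "{i. i < r \<and> x i \<noteq> 0} = S"
  using face_subset[OF assms(1)] assms(2) by (force simp: weights_def)

lemma weights_sum:
  assumes "S \<in> faces" "x \<in> weights S k"
  shows "(\<Sum>i<r. x i) = real k" "(\<Sum>i<r. x i * v i c) = (\<Sum>i\<in>S. x i * v i c)" "x i \<ge> 0"
    "i \<ge> r \<Longrightarrow> x i = 0"
proof -
  show "(\<Sum>i<r. x i) = real k"
    using sum_face[OF assms(1), of x "\<lambda>_. 1"] assms(2) by (simp add: weights_def)
  show "(\<Sum>i<r. x i * v i c) = (\<Sum>i\<in>S. x i * v i c)"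
    by (rule sum_face[OF assms(1)]) (use assms(2) in \<open>simp add: weights_def\<close>)
  show "x i \<ge> 0"
    using assms(2) by (cases "i \<in> S") (auto simp: weights_def less_imp_le)
  show "i \<ge> r \<Longrightarrow> x i = 0"
    using assms(2) face_subset[OF assms(1)] by (force simp: weights_def)
qed

lemma finite_dilate_points: "finite (dilate_points k)"
proof -
  define B where "B = real k * (\<Sum>i<r. \<Sum>c<n. \<bar>v i c\<bar>)"
  have "dilate_points k \<subseteq> {z. \<forall>c. (c \<in> {..<n} \<longrightarrow> z c \<in> {w \<in> \<int>. \<bar>w\<bar> \<le> B}) \<and> (c \<notin> {..<n} \<longrightarrow> z c = 0)}"
  proof
    fix z assume "z \<in> dilate_points k"
    from this[unfolded dilate_points_def mem_Collect_eq]
    obtain x where zx: "\<forall>c\<ge>n. z c = 0" "\<forall>c<n. z c \<in> \<int>"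
      "\<forall>i<r. x i \<ge> 0" "(\<Sum>i<r. x i) = real k" "\<forall>c<n. z c = (\<Sum>i<r. x i * v i c)"
      by (elim exE conjE)
    note z = zx(1,2)[rule_format] and x = zx(3-5)[rule_format]
    have xk: "x i \<le> real k" if "i < r" for i
      using member_le_sum[of i "{..<r}" x] x(1,2) that by auto
    have "\<bar>z c\<bar> \<le> B" if c: "c < n" for c
    proof -
      have "\<bar>z c\<bar> \<le> (\<Sum>i<r. \<bar>x i * v i c\<bar>)" unfolding x(3)[OF c] by (rule sum_abs)
      also have "\<dots> \<le> (\<Sum>i<r. real k * (\<Sum>c<n. \<bar>v i c\<bar>))"
      proof (rule sum_mono)
        fix i assume i: "i \<in> {..<r}"
        have "\<bar>v i c\<bar> \<le> (\<Sum>c<n. \<bar>v i c\<bar>)" using c by (intro member_le_sum) auto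
        then show "\<bar>x i * v i c\<bar> \<le> real k * (\<Sum>c<n. \<bar>v i c\<bar>)"
          unfolding abs_mult using xk[of i] x(1)[of i] i by (intro mult_mono) auto
      qed
      also have "\<dots> = B" by (simp add: B_def sum_distrib_left)
      finally show ?thesis .
    qed
    then show "z \<in> {z. \<forall>c. (c \<in> {..<n} \<longrightarrow> z c \<in> {w \<in> \<int>. \<bar>w\<bar> \<le> B}) \<and> (c \<notin> {..<n} \<longrightarrow> z c = 0)}"
      using z by auto
  qed
  moreover have "finite {z :: nat \<Rightarrow> real. \<forall>c. (c \<in> {..<n} \<longrightarrow> z c \<in> {w \<in> \<int>. \<bar>w\<bar> \<le> B}) \<and> (c \<notin> {..<n} \<longrightarrow> z c = 0)}"
    by (rule finite_set_of_finite_funs) (auto intro: finite_abs_int_segment)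
  ultimately show ?thesis by (rule finite_subset)
qed

text \<open>Surjectivity is the existence of a representation supported on a face, injectivity is
  its uniqueness.\<close>

lemma bij_weights_dilate_points:
  "bij_betw combination (\<Union>S\<in>faces. weights S k) (dilate_points k)"
  unfolding bij_betw_def
proof (intro conjI subset_antisym subsetI inj_onI)
  fix x y assume "x \<in> (\<Union>S\<in>faces. weights S k)" "y \<in> (\<Union>S\<in>faces. weights S k)"
    and eq: "combination x = combination y"
  then obtain S S' where S: "S \<in> faces" "x \<in> weights S k" and S': "S' \<in> faces" "y \<in> weights S' k" by blast
  have "x i = y i" for i
  proof (cases "i < r")
    case True
    show ?thesis
    proof (rule unique_face_representation[OF _ _ _ _ _ _ True])
      show "(\<Sum>i<r. x i * v i c) = (\<Sum>i<r. y i * v i c)" if "c < n" for c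
        using fun_cong[OF eq, of c] that by (simp add: combination_def)
    qed (use weights_sum[OF S] weights_sum[OF S'] weights_support[OF S] weights_support[OF S'] S S' in auto)
  qed (use weights_sum(4)[OF S] weights_sum(4)[OF S'] in auto)
  then show "x = y" by blast
next
  fix z assume "z \<in> combination ` (\<Union>S\<in>faces. weights S k)"
  then obtain S x where S: "S \<in> faces" "x \<in> weights S k" and z: "z = combination x" by blast
  have "(\<Sum>i<r. x i * v i c) \<in> \<int>" if "c < n" for c
    using S(2) that unfolding weights_sum(2)[OF S] by (simp add: weights_def)
  then show "z \<in> dilate_points k"
    unfolding z dilate_points_def combination_def using weights_sum(1,3)[OF S] by auto
next
  fix z assume "z \<in> dilate_points k"
  from this[unfolded dilate_points_def mem_Collect_eq]
  obtain x where zx: "\<forall>c\<ge>n. z c = 0" "\<forall>c<n. z c \<in> \<int>"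
    "\<forall>i<r. x i \<ge> 0" "(\<Sum>i<r. x i) = real k" "\<forall>c<n. z c = (\<Sum>i<r. x i * v i c)"
    by (elim exE conjE)
  note z = zx(1,2)[rule_format] and x = zx(3-5)[rule_format]
  from exists_face_representation[OF zx(3)]
  obtain y where ys: "\<forall>i. y i \<ge> 0" "\<forall>i\<ge>r. y i = 0" "{i. i < r \<and> y i \<noteq> 0} \<in> faces"
    "(\<Sum>i<r. y i) = (\<Sum>i<r. x i)" "\<forall>c<n. (\<Sum>i<r. y i * v i c) = (\<Sum>i<r. x i * v i c)"
    by (elim exE conjE)
  note y = ys[rule_format]
  define S where "S = {i. i < r \<and> y i \<noteq> 0}"
  have S: "S \<in> faces" using y(3) by (simp add: S_def)
  have y0: "y i = 0" if "i \<notin> S" for i using that y(2)[of i] by (cases "i < r") (auto simp: S_def)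
  have sf: "(\<Sum>i<r. y i * g i) = (\<Sum>i\<in>S. y i * g i)" for g
    by (rule sum_face[OF S]) (rule y0)
  have "y \<in> weights S k"
    unfolding weights_def
  proof (intro CollectI conjI ballI allI impI)
    show "y i > 0" if "i \<in> S" for i using y(1)[of i] that by (simp add: S_def order_less_le)
    show "(\<Sum>i\<in>S. y i) = real k" using sf[of "\<lambda>_. 1"] y(4) x(2) by simp
    show "(\<Sum>i\<in>S. y i * v i c) \<in> \<int>" if "c < n" for c
      using z(2)[OF that] unfolding x(3)[OF that] y(5)[OF that, symmetric] sf[of "\<lambda>i. v i c"] .
  qed (fact y0)
  moreover have "combination y = z"
    by (rule ext) (use y(5) x(3) z(1) in \<open>auto simp: combination_def\<close>)
  ultimately show "z \<in> combination ` (\<Union>S\<in>faces. weights S k)" using S by blast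
qed

lemma finite_weights: "S \<in> faces \<Longrightarrow> finite (weights S k)"
  using bij_betw_finite[OF bij_weights_dilate_points] finite_dilate_points finite_faces by auto

lemma card_dilate_points: "card (dilate_points k) = (\<Sum>S\<in>faces. card (weights S k))"
proof -
  have "card (dilate_points k) = card (\<Union>S\<in>faces. weights S k)"
    using bij_betw_same_card[OF bij_weights_dilate_points] by simp
  also have "\<dots> = (\<Sum>S\<in>faces. card (weights S k))"
    by (rule card_UN_disjoint) (use finite_faces finite_weights weights_support in blast)+
  finally show ?thesis .
qed

text \<open>The lattice points at height \<open>h\<close> in the half-open fundamental
  parallelepiped spanned by the integral multiples \<open>L * v i\<close> lifted to height
  \<open>L\<close>. Their numbers form the h-star vector of the open simplex. The interval is open
  at \<open>0\<close> because the simplex is open.\<close>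

definition box :: "nat set \<Rightarrow> nat \<Rightarrow> nat \<Rightarrow> (nat \<Rightarrow> real) set" where
  "box S L h = {x \<in> weights S h. \<forall>i\<in>S. x i \<le> real L}"

definition compositions :: "nat set \<Rightarrow> nat \<Rightarrow> (nat \<Rightarrow> nat) set" where
  "compositions S m = {t. (\<forall>i. i \<notin> S \<longrightarrow> t i = 0) \<and> (\<Sum>i\<in>S. t i) = m}"

lemma weights_add_multiple:
  assumes S: "S \<in> faces"
    and L: "\<And>i c. i \<in> S \<Longrightarrow> c < n \<Longrightarrow> real L * v i c \<in> \<int>"
    and t: "t \<in> compositions S m" and x: "\<And>i. i \<in> S \<Longrightarrow> x i > 0"
  shows "(\<lambda>i. x i + real L * real (t i)) \<in> weights S (h + L * m) \<longleftrightarrow> x \<in> weights S h"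
proof -
  have t: "(\<Sum>i\<in>S. t i) = m" "\<And>i. i \<notin> S \<Longrightarrow> t i = 0" using t by (auto simp: compositions_def)
  have "(\<Sum>i\<in>S. x i + real L * real (t i)) = (\<Sum>i\<in>S. x i) + real L * real m"
    by (simp add: sum.distrib sum_distrib_left[symmetric] t(1)[symmetric])
  moreover have "(\<Sum>i\<in>S. (x i + real L * real (t i)) * v i c) \<in> \<int> \<longleftrightarrow> (\<Sum>i\<in>S. x i * v i c) \<in> \<int>"
    if c: "c < n" for c
  proof -
    have "(\<Sum>i\<in>S. (x i + real L * real (t i)) * v i c)
        = (\<Sum>i\<in>S. x i * v i c) + (\<Sum>i\<in>S. real (t i) * (real L * v i c))"
      by (simp add: distrib_right sum.distrib mult.assoc mult.left_commute)
    moreover have "(\<Sum>i\<in>S. real (t i) * (real L * v i c)) \<in> \<int>"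
      by (rule Ints_sum, rule Ints_mult) (use L c in auto)
    ultimately show ?thesis by simp
  qed
  moreover have "x i + real L * real (t i) > 0" if "i \<in> S" for i
    using x[OF that] by (simp add: add_pos_nonneg)
  ultimately show ?thesis using x t(2) by (auto simp: weights_def)
qed

text \<open>Division of every coefficient by \<open>L\<close> with remainder in
  \<open>{0<..L}\<close>. The remainders form a point of the box, and the quotients a composition of
  \<open>(k - h) div L\<close>.\<close>

lemma bij_box_compositions:
  assumes S: "S \<in> faces" "S \<noteq> {}" and L0: "L > 0"
    and L: "\<And>i c. i \<in> S \<Longrightarrow> c < n \<Longrightarrow> real L * v i c \<in> \<int>"
  shows "bij_betw (\<lambda>(h, x, t) i. x i + real L * real (t i))
    (SIGMA h:{h \<in> {1..card S * L}. h \<le> k \<and> L dvd k - h}. box S L h \<times> compositions S ((k - h) div L))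
    (weights S k)"
    (is "bij_betw ?f ?A _")
  unfolding bij_betw_def
proof (intro conjI subset_antisym subsetI inj_onI)
  fix p q assume pq: "p \<in> ?A" "q \<in> ?A" and eq: "?f p = ?f q"
  obtain h x t where p: "p = (h, x, t)" by (cases p) auto
  obtain h' x' t' where q: "q = (h', x', t')" by (cases q) auto
  have x: "x \<in> box S L h" "t \<in> compositions S ((k - h) div L)"
    and x': "x' \<in> box S L h'" "t' \<in> compositions S ((k - h') div L)" using pq by (auto simp: p q)
  have e: "x i + real L * real (t i) = x' i + real L * real (t' i)" for i
    using fun_cong[OF eq, of i] by (simp add: p q)
  have tt: "t i = t' i" for i
  proof (cases "i \<in> S")
    case True
    have b: "0 < x i" "x i \<le> real L" "0 < x' i" "x' i \<le> real L"
      using x(1) x'(1) True by (auto simp: box_def weights_def)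
    have "real L * (real (t i) - real (t' i)) < real L * 1"
      using e[of i] b by (simp add: algebra_simps)
    then have "real (t i) - real (t' i) < 1" using L0 by (simp only: mult_less_cancel_left_pos of_nat_0_less_iff)
    moreover have "real L * (real (t' i) - real (t i)) < real L * 1"
      using e[of i] b by (simp add: algebra_simps)
    then have "real (t' i) - real (t i) < 1" using L0 by (simp only: mult_less_cancel_left_pos of_nat_0_less_iff)
    ultimately show ?thesis by linarith
  qed (use x x' in \<open>auto simp: compositions_def\<close>)
  then have xx: "x i = x' i" for i using e[of i] by simp
  have "real h = real h'"
    using x(1) x'(1) xx by (simp add: box_def weights_def)
  then show "p = q" using tt xx by (auto simp: p q)
next
  fix y assume "y \<in> ?f ` ?A"
  then obtain h x t where y: "y = (\<lambda>i. x i + real L * real (t i))" and h: "h \<le> k" "L dvd k - h"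
    and x: "x \<in> box S L h" "t \<in> compositions S ((k - h) div L)" by auto
  have "y \<in> weights S (h + L * ((k - h) div L))"
    unfolding y using x(1) by (subst weights_add_multiple[OF S(1) L x(2)]) (auto simp: box_def weights_def)
  then show "y \<in> weights S k" using h by simp
next
  fix y assume y: "y \<in> weights S k"
  \<comment> \<open>The ceiling minus one, not the floor: a coefficient divisible by
    \<open>L\<close> must leave the remainder \<open>L\<close> and not \<open>0\<close>.\<close>
  define t where "t i = (if i \<in> S then nat (\<lceil>y i / real L\<rceil> - 1) else 0)" for i
  define x where "x i = y i - real L * real (t i)" for i
  define m where "m = (\<Sum>i\<in>S. t i)"
  have fin: "finite S" using face_finite S by blast
  have xb: "0 < x i \<and> x i \<le> real L" if i: "i \<in> S" for i
  proof -
    have "y i / real L > 0" using y i L0 by (simp add: weights_def)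
    then have "\<lceil>y i / real L\<rceil> \<ge> 1" by linarith
    then have ti: "real (t i) = real_of_int \<lceil>y i / real L\<rceil> - 1" using i by (simp add: t_def)
    have "real (t i) < y i / real L" "y i / real L \<le> real (t i) + 1" unfolding ti by linarith+
    then have "real L * real (t i) < y i" "y i \<le> real L * (real (t i) + 1)"
      using L0 by (simp_all add: field_simps)
    then show ?thesis by (simp add: x_def algebra_simps)
  qed
  have tc: "t \<in> compositions S m" by (simp add: compositions_def m_def t_def)
  have sumx: "(\<Sum>i\<in>S. x i) = real k - real L * real m"
    using y by (simp add: x_def sum_subtractf weights_def m_def sum_distrib_left)
  \<comment> \<open>Nonemptiness of \<open>S\<close> makes the height positive, so \<open>h\<close>
    starts at \<open>1\<close>.\<close>
  have "(\<Sum>i\<in>S. x i) > 0" using fin S xb by (intro sum_pos) auto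
  then have Lm: "L * m < k" using sumx by (simp flip: of_nat_mult)
  define h where "h = k - L * m"
  have hk: "h + L * m = k" using Lm by (simp add: h_def)
  have "(\<Sum>i\<in>S. x i) \<le> (\<Sum>i\<in>S. real L)" using xb by (intro sum_mono) auto
  also have "real k - real L * real m = real h" using Lm by (simp add: h_def of_nat_diff)
  ultimately have "real h \<le> real (card S * L)" using sumx by simp
  then have h: "1 \<le> h" "h \<le> card S * L" using Lm by (simp_all add: h_def del: of_nat_mult)
  have "y = (\<lambda>i. x i + real L * real (t i))" by (simp add: x_def)
  moreover from this have "x \<in> weights S h"
    using weights_add_multiple[OF S(1) L tc, of x h] xb y hk by simp
  then have "x \<in> box S L h" using xb by (simp add: box_def)
  moreover have "k - h = L * m" using hk by linarith
  then have "h \<le> k \<and> L dvd k - h \<and> (k - h) div L = m" using hk L0 by auto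
  ultimately show "y \<in> ?f ` ?A" using tc h by (intro image_eqI[of _ _ "(h, x, t)"]) auto
qed

text \<open>All heights in the residue class of \<open>j\<close> occur, whether or not they exceed
  the dilation factor; only so do the coefficients depend on the residue alone.\<close>

definition face_poly :: "nat set \<Rightarrow> nat \<Rightarrow> nat \<Rightarrow> real poly" where
  "face_poly S L j = (\<Sum>h \<in> {h \<in> {1..card S * L}. [h = j] (mod L)}.
     smult (real (card (box S L h))) (shifted_binomial (card S - 1) L h))"

lemma card_weights_eq_poly:
  assumes S: "S \<in> faces" "S \<noteq> {}" and L0: "L > 0"
    and L: "\<And>i c. i \<in> S \<Longrightarrow> c < n \<Longrightarrow> real L * v i c \<in> \<int>" and k: "k \<ge> 1"
  shows "real (card (weights S k)) = poly (face_poly S L k) (real k)"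
proof -
  let ?H = "{h \<in> {1..card S * L}. h \<le> k \<and> L dvd k - h}"
  let ?d = "card S - 1"
  have fin: "finite S" using face_finite S by blast
  have c: "card S = Suc ?d" using fin S by (simp add: card_gt_0_iff)
  have finb: "finite (box S L h)" for h using finite_weights[OF S(1)] by (simp add: box_def)
  have comp: "finite (compositions S m)" "card (compositions S m) = (m + ?d) choose ?d" for m
    using card_compositions[OF fin, of m] S by (simp_all add: compositions_def)
  have "real (card (weights S k)) = real (\<Sum>h\<in>?H. card (box S L h) * card (compositions S ((k - h) div L)))"
    using bij_betw_same_card[OF bij_box_compositions[OF S L0 L, where k = k]] finb comp(1)
    by (simp add: card_SigmaI card_cartesian_product)
  also have "\<dots> = (\<Sum>h\<in>?H. poly (smult (real (card (box S L h))) (shifted_binomial ?d L h)) (real k))"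
    unfolding of_nat_sum
  proof (rule sum.cong)
    fix h assume h: "h \<in> ?H"
    then have "h + L * ((k - h) div L) = k" by simp
    with poly_shifted_binomial_choose[OF L0, of ?d h "(k - h) div L"]
    show "real (card (box S L h) * card (compositions S ((k - h) div L)))
      = poly (smult (real (card (box S L h))) (shifted_binomial ?d L h)) (real k)"
      by (simp add: comp)
  qed simp
  \<comment> \<open>The missing heights above \<open>k\<close> are added; they are zeros of their
    polynomials.\<close>
  also have "\<dots> = (\<Sum>h\<in>{h \<in> {1..card S * L}. [h = k] (mod L)}.
      poly (smult (real (card (box S L h))) (shifted_binomial ?d L h)) (real k))"
  proof (rule sum.mono_neutral_left)
    show "?H \<subseteq> {h \<in> {1..card S * L}. [h = k] (mod L)}"
      by (auto intro!: cong_sym[of k] simp: cong_altdef_nat)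
    show "\<forall>h\<in>{h \<in> {1..card S * L}. [h = k] (mod L)} - ?H.
        poly (smult (real (card (box S L h))) (shifted_binomial ?d L h)) (real k) = 0"
    proof
      fix h assume "h \<in> {h \<in> {1..card S * L}. [h = k] (mod L)} - ?H"
      then have h: "h \<le> card S * L" "[h = k] (mod L)" "\<not> (h \<le> k \<and> L dvd k - h)" by auto
      then have hk: "k < h" using cong_altdef_nat[of h k L] cong_sym[OF h(2)] not_le by blast
      then have "L dvd h - k" using h(2) by (simp add: cong_altdef_nat)
      then obtain m where "h - k = L * m" by blast
      then have m: "h = k + L * m" using hk by linarith
      have "m \<ge> 1" using hk m by (cases m) auto
      \<comment> \<open>Here \<open>k\<close> has to be positive: for \<open>k = 0\<close> the top
        height \<open>card S * L\<close> would give \<open>m = card S\<close>, which is not covered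
        by the zeros.\<close>
      moreover have "L * m < L * card S" using m h(1) k mult.commute[of L "card S"] by linarith
      then have "m < card S" by simp
      then have "m \<le> ?d" by linarith
      ultimately show "poly (smult (real (card (box S L h))) (shifted_binomial ?d L h)) (real k) = 0"
        using poly_shifted_binomial_eq_0[OF L0 m] by simp
    qed
  qed simp
  also have "\<dots> = poly (face_poly S L k) (real k)" by (simp add: face_poly_def poly_sum)
  finally show ?thesis .
qed

text \<open>At the maximal height no coefficient can be below its bound \<open>L\<close>.\<close>

lemma box_top:
  assumes S: "S \<in> faces" and L0: "L > 0"
    and L: "\<And>i c. i \<in> S \<Longrightarrow> c < n \<Longrightarrow> real L * v i c \<in> \<int>"
  shows "box S L (card S * L) = {\<lambda>i. if i \<in> S then real L else 0}"
proof (intro subset_antisym subsetI)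
  fix x assume "x \<in> box S L (card S * L)"
  then have x: "\<And>i. i \<in> S \<Longrightarrow> x i \<le> real L" "\<And>i. i \<notin> S \<Longrightarrow> x i = 0" "(\<Sum>i\<in>S. x i) = (\<Sum>i\<in>S. real L)"
    by (auto simp: box_def weights_def)
  have "x i = real L" if "i \<in> S" for i
    using sum_mono_inv[OF x(3) x(1) that face_finite[OF S]] by simp
  then show "x \<in> {\<lambda>i. if i \<in> S then real L else 0}" using x(2) by auto
next
  fix x :: "nat \<Rightarrow> real" assume "x \<in> {\<lambda>i. if i \<in> S then real L else 0}"
  then have x: "x = (\<lambda>i. if i \<in> S then real L else 0)" by simp
  have "(\<Sum>i\<in>S. x i * v i c) \<in> \<int>" if "c < n" for c
    by (rule Ints_sum) (use L that in \<open>simp add: x\<close>)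
  then show "x \<in> box S L (card S * L)" using L0 by (simp add: box_def weights_def x)
qed

text \<open>All heights below the top one vanish at \<open>0\<close>, and the top one carries a
  single box point. The value is \<open>(- 1)\<close> to the dimension, the compactly supported
  Euler characteristic of an open simplex.\<close>

lemma poly_face_poly_0:
  assumes S: "S \<in> faces" "S \<noteq> {}" and L0: "L > 0"
    and L: "\<And>i c. i \<in> S \<Longrightarrow> c < n \<Longrightarrow> real L * v i c \<in> \<int>"
  shows "poly (face_poly S L 0) 0 = - ((- 1) ^ card S)"
proof -
  let ?d = "card S - 1"
  let ?p = "\<lambda>h. poly (smult (real (card (box S L h))) (shifted_binomial ?d L h)) 0"
  have c: "card S = Suc ?d" using face_finite S by (simp add: card_gt_0_iff)
  have "poly (face_poly S L 0) 0 = (\<Sum>h\<in>{h \<in> {1..card S * L}. [h = 0] (mod L)}. ?p h)"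
    by (simp add: face_poly_def poly_sum)
  also have "\<dots> = (\<Sum>h\<in>{card S * L}. ?p h)"
  proof (rule sum.mono_neutral_right)
    show "{card S * L} \<subseteq> {h \<in> {1..card S * L}. [h = 0] (mod L)}"
      using L0 S face_finite[OF S(1)] by (auto simp: cong_0_iff Suc_le_eq card_gt_0_iff)
    show "\<forall>h\<in>{h \<in> {1..card S * L}. [h = 0] (mod L)} - {card S * L}. ?p h = 0"
    proof
      fix h assume "h \<in> {h \<in> {1..card S * L}. [h = 0] (mod L)} - {card S * L}"
      then have h: "1 \<le> h" "h < L * card S" "L dvd h" by (auto simp: cong_0_iff mult.commute)
      then obtain m where m: "h = 0 + L * m" by auto
      then have "1 \<le> m" "m \<le> ?d" using h c by (cases m, auto)
      then show "?p h = 0" using poly_shifted_binomial_eq_0[OF L0 m] by simp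
    qed
  qed simp
  also have "\<dots> = (- 1) ^ ?d"
    using poly_shifted_binomial_0[OF L0, of ?d] c box_top[OF S(1) L0 L] by simp
  also have "\<dots> = - ((- 1) ^ card S)" by (subst (2) c) simp
  finally show ?thesis .
qed

text \<open>The term of height \<open>h\<close> is positive beyond \<open>h - L\<close>, and
  \<open>h\<close> is at most \<open>card S * L\<close>. The coefficients are cardinalities, so one
  nonzero term makes the sum positive.\<close>

lemma face_poly_pos:
  assumes S: "S \<in> faces" "S \<noteq> {}" and L0: "L > 0"
  shows "face_poly S L j = 0 \<or> (\<forall>x > real ((card S - 1) * L). poly (face_poly S L j) x > 0)"
proof (cases "face_poly S L j = 0", simp, rule disjI2, intro allI impI)
  fix x assume ne: "face_poly S L j \<noteq> 0" and x: "x > real ((card S - 1) * L)"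
  let ?H = "{h \<in> {1..card S * L}. [h = j] (mod L)}"
  have c: "card S = Suc (card S - 1)" using face_finite S by (simp add: card_gt_0_iff)
  have pos: "poly (shifted_binomial (card S - 1) L h) x > 0" if "h \<in> ?H" for h
  proof (rule poly_shifted_binomial_pos[OF L0])
    have "h \<le> (card S - 1) * L + L" using that by (subst (asm) c) auto
    then have "real h \<le> real ((card S - 1) * L) + real L" by (simp only: of_nat_add[symmetric] of_nat_le_iff)
    then show "x > real h - real L" using x by linarith
  qed
  from ne obtain h where h: "h \<in> ?H" "smult (real (card (box S L h))) (shifted_binomial (card S - 1) L h) \<noteq> 0"
    using sum.neutral[of ?H "\<lambda>h. smult (real (card (box S L h))) (shifted_binomial (card S - 1) L h)"]
    unfolding face_poly_def by blast
  have "0 < poly (smult (real (card (box S L h))) (shifted_binomial (card S - 1) L h)) x"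
    using pos[OF h(1)] h(2) by (auto simp: zero_less_mult_iff)
  also have "\<dots> \<le> (\<Sum>h\<in>?H. poly (smult (real (card (box S L h))) (shifted_binomial (card S - 1) L h)) x)"
    by (rule member_le_sum) (use h(1) pos in \<open>auto intro!: mult_nonneg_nonneg intro: less_imp_le\<close>)
  finally show "poly (face_poly S L j) x > 0" by (simp add: face_poly_def poly_sum)
qed

lemma face_poly_cong:
  "[i = j] (mod L) \<Longrightarrow> face_poly S L i = face_poly S L j"
  unfolding face_poly_def by (rule sum.cong) (auto intro: cong_trans cong_sym)

text \<open>At \<open>k = 0\<close> the open faces contribute the signs of an Euler characteristic, which is \<open>1\<close>.\<close>

lemma dilate_points_quasi_polynomial:
  fixes D :: "nat \<Rightarrow> nat"
  assumes D: "\<And>i. i < r \<Longrightarrow> D i \<ge> 1 \<and> D i \<le> M" and M: "M \<ge> 1"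
    and int: "\<And>i c. i < r \<Longrightarrow> c < n \<Longrightarrow> real (D i) * v i c \<in> \<int>"
  obtains l c where "l \<ge> 1" "\<And>i j. [i = j] (mod l) \<Longrightarrow> c i = c j"
    "\<And>k. k \<ge> 1 \<Longrightarrow> real (card (dilate_points k)) = poly (c k) (real k)"
    "poly (c 0) 0 = (if r = 0 then 0 else 1)"
    "\<And>j x. c j \<noteq> 0 \<Longrightarrow> x > real (n * M ^ (n + 1)) \<Longrightarrow> poly (c j) x > 0"
proof -
  \<comment> \<open>Every simplex gets its own common denominator, a product of at most
    \<open>n + 1\<close> vertex denominators.\<close>
  define L where "L S = (\<Prod>i\<in>S. D i)" for S
  define F where "F = faces - {{}}"
  have F: "S \<in> faces" "S \<noteq> {}" "S \<subseteq> {..<r}" "finite S" if "S \<in> F" for S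
    using that face_finite face_subset by (auto simp: F_def)
  have empty: "{} \<in> faces"
  \<comment> \<open>A dependence has coefficient sum zero, so a positive entry forces a negative
    one.\<close>
  proof (rule facesI)
    fix \<kappa> assume \<kappa>: "affine_dependence \<kappa>" "lex_pos r \<kappa>"
    then obtain i where i: "i < r" "\<kappa> i > 0" unfolding lex_pos_def by blast
    show "\<exists>i<r. i \<notin> {} \<and> \<kappa> i < 0"
    proof (rule ccontr)
      assume "\<not> ?thesis"
      then have "(\<Sum>j<r. \<kappa> j) \<ge> \<kappa> i" using i by (intro member_le_sum) auto
      then show False using \<kappa>(1) i by (simp add: affine_dependence_def)
    qed
  qed simp
  have L0: "L S > 0" if "S \<in> F" for S
    unfolding L_def by (rule prod_pos) (use F(3)[OF that] D in force)
  have Lint: "real (L S) * v i c \<in> \<int>" if "S \<in> F" "i \<in> S" "c < n" for S i c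
  proof -
    have "L S = (\<Prod>j\<in>S - {i}. D j) * D i"
      unfolding L_def using F(4)[OF that(1)] that(2) by (simp add: prod.remove mult.commute)
    moreover have "i < r" using F(3) that by blast
    ultimately show ?thesis using int[of i c] that(3) by (simp add: mult.assoc Ints_mult Ints_prod)
  qed
  have LM: "real ((card S - 1) * L S) \<le> real (n * M ^ (n + 1))" if "S \<in> F" for S
  proof -
    have c: "card S \<le> n + 1" using card_face_le F that by blast
    have "L S \<le> (\<Prod>i\<in>S. M)" unfolding L_def by (rule prod_mono) (use F(3)[OF that] D in force)
    also have "\<dots> \<le> M ^ (n + 1)" using power_increasing[OF c M] by simp
    finally have "(card S - 1) * L S \<le> n * M ^ (n + 1)" using c by (intro mult_mono) auto
    then show ?thesis by (simp only: of_nat_le_iff)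
  qed
  define c where "c j = (\<Sum>S\<in>F. face_poly S (L S) j)" for j
  have finF: "finite F" using finite_faces by (simp add: F_def)
  have split: "(\<Sum>S\<in>faces. g S) = g {} + (\<Sum>S\<in>F. g S)" for g :: "nat set \<Rightarrow> real"
    unfolding F_def by (rule sum.remove[OF finite_faces empty])
  show ?thesis
  \<comment> \<open>Every \<open>L S\<close> divides the product over all vertices, which therefore
    is a common period.\<close>
  proof (rule that[of "L {..<r}" c])
    show "L {..<r} \<ge> 1"
      unfolding L_def by (rule prod_ge_1) (use D in auto)
    show "c i = c j" if "[i = j] (mod L {..<r})" for i j
      unfolding c_def
    proof (rule sum.cong)
      fix S assume "S \<in> F"
      then have "L S dvd L {..<r}" unfolding L_def using F(3) by (intro prod_dvd_prod_subset) auto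
      then show "face_poly S (L S) i = face_poly S (L S) j"
        using that by (intro face_poly_cong) (rule cong_dvd_modulus_nat)
    qed simp
    show "real (card (dilate_points k)) = poly (c k) (real k)" if k: "k \<ge> 1" for k
    proof -
      have "weights {} k = {}" using k by (auto simp: weights_def)
      moreover have "real (card (weights S k)) = poly (face_poly S (L S) k) (real k)" if "S \<in> F" for S
        by (rule card_weights_eq_poly[OF F(1,2)[OF that] L0[OF that] Lint[OF that] k])
      ultimately show ?thesis by (simp add: card_dilate_points split c_def poly_sum)
    qed
    show "poly (c 0) 0 = (if r = 0 then 0 else 1)"
    proof -
      have "poly (c 0) 0 = (\<Sum>S\<in>F. - ((- 1) ^ card S))"
        unfolding c_def poly_sum
        by (rule sum.cong) (use poly_face_poly_0 F L0 Lint in auto)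
      \<comment> \<open>The \<open>1\<close> compensates the empty face: it belongs to the
        alternating sum but not to \<open>F\<close>.\<close>
      also have "\<dots> = 1 - (\<Sum>S\<in>faces. (- 1) ^ card S)" by (simp add: split sum_negf)
      also have "\<dots> = (if r = 0 then 0 else 1)"
      proof (cases "r = 0")
        case True
        then have "faces = {{}}" using empty face_subset by auto
        then show ?thesis using True by simp
      qed (use faces_alternating_sum in simp)
      finally show ?thesis .
    qed
    show "poly (c j) x > 0" if cj: "c j \<noteq> 0" and x: "x > real (n * M ^ (n + 1))" for j x
    proof -
      have pos: "face_poly S (L S) j \<noteq> 0 \<Longrightarrow> poly (face_poly S (L S) j) x > 0" if S: "S \<in> F" for S
        using face_poly_pos[OF F(1,2)[OF S] L0[OF S], of j] LM[OF S] x by force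
      obtain S where S: "S \<in> F" "face_poly S (L S) j \<noteq> 0"
        using cj sum.neutral[of F "\<lambda>S. face_poly S (L S) j"] unfolding c_def by meson
      have "0 < poly (face_poly S (L S) j) x" using pos S by blast
      also have "\<dots> \<le> (\<Sum>S\<in>F. poly (face_poly S (L S) j) x)"
        by (rule member_le_sum[OF S(1) _ finF]) (use pos in \<open>force simp: less_imp_le\<close>)
      finally show ?thesis by (simp add: c_def poly_sum)
    qed
  qed
qed

end

section \<open>Ehrhart quasi-polynomials\<close>

lemma quasi_polynomial_from_residues:
  assumes l: "l \<ge> 1" and c: "\<And>i j. [i = j] (mod l) \<Longrightarrow> c i = c j"
    and f: "\<And>k. f k = poly (c k) (real k)"
    and pos: "\<And>j x. c j \<noteq> 0 \<Longrightarrow> x > real s \<Longrightarrow> poly (c j) x > 0"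
  shows "quasi_polynomial f" "strictly_saturated (\<lambda>k. f (k + s))"
proof -
  have "f k = poly (c j) (real k)" if "[k = j] (mod l)" for k j using f[of k] c[OF that] by simp
  then have "constituents f l c" using l by (simp add: constituents_def)
  then show "quasi_polynomial f" unfolding quasi_polynomial_def by blast
  \<comment> \<open>The index \<open>j + s\<close> may exceed the period, which is why
    \<open>c\<close> is a family over all naturals that respects congruence. Since \<open>k\<close>
    is at least \<open>1\<close>, the argument \<open>s + k\<close> is strictly above the
    threshold.\<close>
  define c' where "c' j = pcompose (c (j + s)) [:real s, 1:]" for j
  have "f (k + s) = poly (c' j) (real k)" if "[k = j] (mod l)" for k j
    using f[of "k + s"] c[of "k + s" "j + s"] that by (simp add: c'_def poly_pcompose cong_add_rcancel_nat add.commute)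
  then have "constituents (\<lambda>k. f (k + s)) l c'" using l by (simp add: constituents_def)
  moreover have "poly (c' j) (real k) > 0" if "c' j \<noteq> 0" "k \<ge> 1" for j k
  proof -
    have "c (j + s) \<noteq> 0" using that(1) by (auto simp: c'_def)
    from pos[OF this, of "real s + real k"] show ?thesis using that(2) by (simp add: c'_def poly_pcompose)
  qed
  ultimately show "strictly_saturated (\<lambda>k. f (k + s))"
    unfolding strictly_saturated_def by blast
qed

lemma polyhedron_convex_combination:
  assumes "finite V" "V \<subseteq> polyhedron n I a b" "\<And>w. w \<in> V \<Longrightarrow> \<mu> w \<ge> 0" "(\<Sum>w\<in>V. \<mu> w) = 1"
  shows "(\<lambda>j. \<Sum>w\<in>V. \<mu> w * w j) \<in> polyhedron n I a b"
  unfolding polyhedron_def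
proof (intro CollectI conjI allI impI ballI)
  show "(\<Sum>w\<in>V. \<mu> w * w j) = 0" if "n \<le> j" for j
    by (rule sum.neutral) (use assms(2) that in \<open>auto simp: polyhedron_def\<close>)
  show "(\<Sum>j<n. a i j * (\<Sum>w\<in>V. \<mu> w * w j)) \<le> b i" if "i \<in> I" for i
  proof -
    have "(\<Sum>j<n. a i j * (\<Sum>w\<in>V. \<mu> w * w j)) = (\<Sum>j<n. \<Sum>w\<in>V. \<mu> w * (a i j * w j))"
      by (simp add: sum_distrib_left mult_ac)
    also have "\<dots> = (\<Sum>w\<in>V. \<mu> w * (\<Sum>j<n. a i j * w j))"
      by (subst sum.swap) (simp add: sum_distrib_left)
    also have "\<dots> \<le> (\<Sum>w\<in>V. \<mu> w * b i)"
      by (intro sum_mono mult_left_mono) (use assms(2,3) that in \<open>auto simp: polyhedron_def\<close>)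
    also have "\<dots> = b i" by (simp add: sum_distrib_right[symmetric] assms(4))
    finally show ?thesis .
  qed
qed

section \<open>Transfer between vectors and coordinate functions\<close>

definition coords :: "nat \<Rightarrow> real vec \<Rightarrow> nat \<Rightarrow> real" where
  "coords n x j = (if j < n then x $ j else 0)"

lemma inj_on_coords: "inj_on (coords n) (carrier_vec n)"
proof (rule inj_onI)
  fix x y :: "real vec" assume xy: "x \<in> carrier_vec n" "y \<in> carrier_vec n" "coords n x = coords n y"
  have "x $ j = y $ j" if "j < n" for j using fun_cong[OF xy(3), of j] that by (simp add: coords_def)
  then show "x = y" using xy by auto
qed

lemma coords_vec: "(\<And>j. j \<ge> n \<Longrightarrow> x j = 0) \<Longrightarrow> coords n (vec n x) = x"
  by (auto simp: coords_def fun_eq_iff)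

lemma mem_solution_set_iff:
  assumes "A \<in> carrier_mat m n" "b \<in> carrier_vec m" "x \<in> carrier_vec n"
  shows "x \<in> solution_set n A b \<longleftrightarrow>
    coords n x \<in> polyhedron n {..<m} (\<lambda>i j. real_of_rat (A $$ (i, j))) (\<lambda>i. real_of_rat (b $ i))"
  using assms
  by (auto simp: solution_set_def polyhedron_def less_eq_vec_def scalar_prod_def coords_def atLeast0LessThan)

lemma bounded_polyhedron:
  assumes A: "A \<in> carrier_mat m n" "b \<in> carrier_vec m"
    and bd: "bounded_in n (solution_set n A b)"
  obtains B where "\<forall>y\<in>polyhedron n {..<m} (\<lambda>i j. real_of_rat (A $$ (i, j))) (\<lambda>i. real_of_rat (b $ i)).
    \<forall>j<n. \<bar>y j\<bar> \<le> B"
proof -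
  obtain B where B: "\<forall>x\<in>solution_set n A b. \<forall>i<n. \<bar>x $ i\<bar> \<le> B"
    using bd unfolding bounded_in_def by blast
  have "\<bar>y j\<bar> \<le> B"
    if y: "y \<in> polyhedron n {..<m} (\<lambda>i j. real_of_rat (A $$ (i, j))) (\<lambda>i. real_of_rat (b $ i))"
      and j: "j < n" for y j
  proof -
    have "coords n (vec n y) = y" using y by (intro coords_vec) (auto simp: polyhedron_def)
    then have "vec n y \<in> solution_set n A b" using mem_solution_set_iff[OF A, of "vec n y"] y by simp
    then have "\<bar>vec n y $ j\<bar> \<le> B" using B j by blast
    then show ?thesis using j by simp
  qed
  then show ?thesis using that by blast
qed

text \<open>Needed for the value at \<open>k = 0\<close>. A point of a bounded polyhedron is a
  convex combination of vertices, and weights over an empty set cannot sum to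
  \<open>1\<close>.\<close>

lemma basic_points_empty_iff:
  assumes A: "A \<in> carrier_mat m n" "b \<in> carrier_vec m"
    and bd: "bounded_in n (solution_set n A b)"
  shows "basic_points n {..<m} (\<lambda>i j. real_of_rat (A $$ (i, j))) (\<lambda>i. real_of_rat (b $ i)) = {}
    \<longleftrightarrow> solution_set n A b = {}" (is "?V = {} \<longleftrightarrow> _")
proof
  assume V: "?V = {}"
  show "solution_set n A b = {}"
  proof (rule ccontr)
    assume "solution_set n A b \<noteq> {}"
    then obtain x where x: "x \<in> solution_set n A b" by blast
    then have "x \<in> carrier_vec n" by (simp add: solution_set_def)
    from x[unfolded mem_solution_set_iff[OF A this]]
    have xQ: "coords n x \<in> polyhedron n {..<m} (\<lambda>i j. real_of_rat (A $$ (i, j))) (\<lambda>i. real_of_rat (b $ i))" .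
    obtain B where "\<forall>y\<in>polyhedron n {..<m} (\<lambda>i j. real_of_rat (A $$ (i, j))) (\<lambda>i. real_of_rat (b $ i)).
        \<forall>j<n. \<bar>y j\<bar> \<le> B" using bounded_polyhedron[OF A bd] by blast
    from convex_combination_basic_points[OF _ this xQ] V show False by simp
  qed
next
  assume P: "solution_set n A b = {}"
  have "w \<notin> ?V" for w
  proof
    assume "w \<in> ?V"
    then have w: "w \<in> polyhedron n {..<m} (\<lambda>i j. real_of_rat (A $$ (i, j))) (\<lambda>i. real_of_rat (b $ i))"
      by (simp add: basic_points_def)
    then have "coords n (vec n w) = w" by (intro coords_vec) (simp add: polyhedron_def)
    then show False using P w mem_solution_set_iff[OF A, of "vec n w"] by simp
  qed
  then show "?V = {}" by blast
qed

text \<open>The coefficients on the right are \<open>k\<close> times those of a convex combination,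
  so a positive \<open>k\<close> is needed to divide back. For \<open>k = 0\<close> and no vertices
  the sides would differ: \<open>dilate_points 0\<close> contains the origin, but every dilate of
  the empty set is empty.\<close>

lemma card_dilate_eq_ehrhart:
  assumes A: "A \<in> carrier_mat m n" "b \<in> carrier_vec m"
    and bd: "bounded_in n (solution_set n A b)"
    and V: "V = basic_points n {..<m} (\<lambda>i j. real_of_rat (A $$ (i, j))) (\<lambda>i. real_of_rat (b $ i))"
    and v: "bij_betw v {..<r} V" and k: "k \<ge> 1"
  shows "ehrhart n (solution_set n A b) k = card (point_configuration.dilate_points n r v k)"
proof -
  interpret point_configuration n r v .
  let ?a = "\<lambda>i j. real_of_rat (A $$ (i, j))" and ?b = "\<lambda>i. real_of_rat (b $ i)"
  let ?P = "solution_set n A b" and ?Q = "polyhedron n {..<m} ?a ?b"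
  note mem = mem_solution_set_iff[OF A]
  have Pc: "?P \<subseteq> carrier_vec n" by (auto simp: solution_set_def)
  have finV: "finite V" unfolding V by (rule finite_basic_points) simp
  have VQ: "V \<subseteq> ?Q" by (auto simp: V basic_points_def)
  have sumV: "(\<Sum>w\<in>V. g w) = (\<Sum>i<r. g (v i))" for g :: "(nat \<Rightarrow> real) \<Rightarrow> real"
    by (rule sum.reindex_bij_betw[OF v, symmetric])
  obtain B where BQ: "\<forall>y\<in>?Q. \<forall>j<n. \<bar>y j\<bar> \<le> B"
    using bounded_polyhedron[OF A bd] by blast
  have img: "coords n ` ((\<lambda>x. real k \<cdot>\<^sub>v x) ` ?P \<inter> integer_points n) = dilate_points k"
  proof (intro subset_antisym subsetI)
    fix z assume "z \<in> coords n ` ((\<lambda>x. real k \<cdot>\<^sub>v x) ` ?P \<inter> integer_points n)"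
    then obtain x where x: "x \<in> ?P" "real k \<cdot>\<^sub>v x \<in> integer_points n" and z: "z = coords n (real k \<cdot>\<^sub>v x)"
      by blast
    have xc: "x \<in> carrier_vec n" using x Pc by blast
    have "coords n x \<in> ?Q" using mem[OF xc] x by simp
    from convex_combination_basic_points[OF _ BQ this] V obtain \<mu> where \<mu>:
      "\<forall>w\<in>V. \<mu> w \<ge> 0" "(\<Sum>w\<in>V. \<mu> w) = 1" "\<forall>j. coords n x j = (\<Sum>w\<in>V. \<mu> w * w j)"
      by auto
    have zj: "z j = real k * coords n x j" for j using xc by (simp add: z coords_def)
    show "z \<in> dilate_points k"
      unfolding dilate_points_def
    proof (intro CollectI conjI exI[of _ "\<lambda>i. real k * \<mu> (v i)"] allI impI)
      show "z j = 0" if "n \<le> j" for j using that by (simp add: z coords_def)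
      show "z j \<in> \<int>" if "j < n" for j using x(2) that by (simp add: z coords_def integer_points_def)
      show "real k * \<mu> (v i) \<ge> 0" if "i < r" for i
        using \<mu>(1) that v by (auto simp: bij_betw_def)
      show "(\<Sum>i<r. real k * \<mu> (v i)) = real k"
        using \<mu>(2) sumV[of \<mu>] by (simp add: sum_distrib_left[symmetric])
      show "z c = (\<Sum>i<r. real k * \<mu> (v i) * v i c)" if "c < n" for c
        using \<mu>(3) sumV[of "\<lambda>w. \<mu> w * w c"] by (simp add: zj sum_distrib_left mult.assoc)
    qed
  next
    fix z assume "z \<in> dilate_points k"
    from this[unfolded dilate_points_def mem_Collect_eq]
    obtain x where zx: "\<forall>c\<ge>n. z c = 0" "\<forall>c<n. z c \<in> \<int>"
      "\<forall>i<r. x i \<ge> 0" "(\<Sum>i<r. x i) = real k" "\<forall>c<n. z c = (\<Sum>i<r. x i * v i c)"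
      by (elim exE conjE)
    define \<mu> where "\<mu> w = x (inv_into {..<r} v w) / real k" for w
    have \<mu>v: "\<mu> (v i) = x i / real k" if "i < r" for i
      using v that by (simp add: \<mu>_def bij_betw_def)
    have zV: "z c / real k = (\<Sum>w\<in>V. \<mu> w * w c)" for c
    proof -
      have "(\<Sum>w\<in>V. \<mu> w * w c) = (\<Sum>i<r. x i * v i c) / real k"
        unfolding sumV by (simp add: \<mu>v sum_divide_distrib)
      moreover have "(\<Sum>w\<in>V. \<mu> w * w c) = 0" if "n \<le> c"
        by (rule sum.neutral) (use VQ that in \<open>auto simp: polyhedron_def\<close>)
      ultimately show ?thesis using zx(1,5) by (cases "c < n") auto
    qed
    have "(\<lambda>c. z c / real k) \<in> ?Q"
      unfolding zV
    proof (rule polyhedron_convex_combination[OF finV VQ])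
      show "\<mu> w \<ge> 0" if "w \<in> V" for w
        using that v zx(3) by (auto simp: \<mu>v bij_betw_def)
      show "(\<Sum>w\<in>V. \<mu> w) = 1"
        unfolding sumV using zx(4) k by (simp add: \<mu>v sum_divide_distrib[symmetric])
    qed
    moreover have "coords n (vec n (\<lambda>c. z c / real k)) = (\<lambda>c. z c / real k)"
      by (rule coords_vec) (use zx(1) in simp)
    ultimately have "vec n (\<lambda>c. z c / real k) \<in> ?P" using mem by simp
    moreover have "real k \<cdot>\<^sub>v vec n (\<lambda>c. z c / real k) = vec n z" using k by (intro eq_vecI) auto
    moreover have "vec n z \<in> integer_points n" using zx(2) by (simp add: integer_points_def)
    moreover have "coords n (vec n z) = z" by (rule coords_vec) (use zx(1) in simp)
    ultimately show "z \<in> coords n ` ((\<lambda>x. real k \<cdot>\<^sub>v x) ` ?P \<inter> integer_points n)"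
      by (metis (no_types, lifting) IntI image_eqI)
  qed
  have "inj_on (coords n) ((\<lambda>x. real k \<cdot>\<^sub>v x) ` ?P \<inter> integer_points n)"
    by (rule inj_on_subset[OF inj_on_coords]) (auto simp: integer_points_def)
  from card_image[OF this] show ?thesis unfolding img ehrhart_def by simp
qed

lemma ehrhart_0:
  assumes "P \<subseteq> carrier_vec n"
  shows "ehrhart n P 0 = (if P = {} then 0 else 1)"
proof -
  have "real 0 \<cdot>\<^sub>v x = 0\<^sub>v n" if "x \<in> P" for x using that assms by (intro eq_vecI) auto
  then have "(\<lambda>x. real 0 \<cdot>\<^sub>v x) ` P \<inter> integer_points n = (if P = {} then {} else {0\<^sub>v n})"
    by (auto simp: integer_points_def)
  then show ?thesis by (simp add: ehrhart_def)
qed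

section \<open>Vertex denominators in terms of bitlengths\<close>

lemma bitlength_bounds:
  assumes A: "A \<in> carrier_mat m n" and b: "b \<in> carrier_vec m" and i: "i < m"
  shows "j < n \<Longrightarrow> \<bar>fst (quotient_of (A $$ (i, j)))\<bar> \<le> 2 ^ max_bitlength A b"
    "j < n \<Longrightarrow> snd (quotient_of (A $$ (i, j))) \<le> 2 ^ max_bitlength A b"
    "snd (quotient_of (b $ i)) \<le> 2 ^ max_bitlength A b"
proof -
  let ?X = "{bitlength_rat (A $$ (i, j)) | i j. i < dim_row A \<and> j < dim_col A}"
  let ?Y = "{floorlog 2 (nat (snd (quotient_of (b $ i)))) | i. i < dim_vec b}"
  have "?X = (\<lambda>(i, j). bitlength_rat (A $$ (i, j))) ` ({..<dim_row A} \<times> {..<dim_col A})" by force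
  then have finX: "finite ?X" by simp
  have le: "y \<le> max_bitlength A b" if "y \<in> ?X \<union> ?Y" for y
    unfolding max_bitlength_def using that finX by (intro Max_ge) auto
  have bound: "x \<le> 2 ^ max_bitlength A b" if "floorlog 2 (nat x) \<le> max_bitlength A b" for x :: int
    using floorlog_leD[OF that] by simp
  {
    assume j: "j < n"
    have "bitlength_rat (A $$ (i, j)) \<le> max_bitlength A b" using A i j by (intro le) auto
    then show "\<bar>fst (quotient_of (A $$ (i, j)))\<bar> \<le> 2 ^ max_bitlength A b"
      "snd (quotient_of (A $$ (i, j))) \<le> 2 ^ max_bitlength A b"
      unfolding bitlength_rat_def by (auto intro!: bound)
  }
  show "snd (quotient_of (b $ i)) \<le> 2 ^ max_bitlength A b"
    using b i by (intro bound le) auto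
qed

text \<open>Each row is cleared separately, by the denominators of its entries and of its right-hand
  side. The latter becomes an integer of unrestricted size, which is all that Cramer's rule asks
  for.\<close>

lemma basic_point_denominator:
  assumes A: "A \<in> carrier_mat m n" and b: "b \<in> carrier_vec m"
    and w: "w \<in> basic_points n {..<m} (\<lambda>i j. real_of_rat (A $$ (i, j))) (\<lambda>i. real_of_rat (b $ i))"
  obtains D :: nat where "D \<ge> 1" "D \<le> fact n * (2 ^ (max_bitlength A b * (n + 2))) ^ n"
    "\<And>j. j < n \<Longrightarrow> real D * w j \<in> \<int>"
proof -
  let ?a = "\<lambda>i j. real_of_rat (A $$ (i, j))" and ?b = "\<lambda>i. real_of_rat (b $ i)"
  define T where "T = tight n {..<m} ?a ?b w"
  have T: "T \<subseteq> {..<m}" "trivial_kernel n T ?a" "\<And>i. i \<in> T \<Longrightarrow> (\<Sum>j<n. ?a i j * w j) = ?b i"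
    using w by (auto simp: T_def tight_def basic_points_def)
  define p q where "p x = fst (quotient_of x)" and "q x = snd (quotient_of x)" for x
  have q0: "q x > 0" for x by (simp add: q_def quotient_of_denom_pos')
  have pq: "real_of_int (q x) * real_of_rat x = real_of_int (p x)" for x
  proof -
    have "x = of_int (p x) / of_int (q x)" by (rule quotient_of_div) (simp add: p_def q_def)
    then have "real_of_rat x = real_of_int (p x) / real_of_int (q x)" by (metis of_rat_divide of_rat_of_int_eq)
    then show ?thesis using q0[of x] by simp
  qed
  define Q where "Q i = (\<Prod>j<n. q (A $$ (i, j)))" for i
  define g where "g i j = p (A $$ (i, j)) * (\<Prod>l\<in>{..<n} - {j}. q (A $$ (i, l))) * q (b $ i)" for i j
  have Q0: "Q i > 0" for i unfolding Q_def by (rule prod_pos) (use q0 in auto)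
  have g: "real_of_int (g i j) = real_of_int (Q i * q (b $ i)) * ?a i j" if "j < n" for i j
  proof -
    have "Q i = q (A $$ (i, j)) * (\<Prod>l\<in>{..<n} - {j}. q (A $$ (i, l)))"
      unfolding Q_def using that by (simp add: prod.remove)
    then show ?thesis using pq[of "A $$ (i, j)", symmetric] by (simp add: g_def)
  qed
  define \<psi> where "\<psi> = max_bitlength A b"
  have bnd: "\<bar>p (A $$ (i, j))\<bar> \<le> 2 ^ \<psi>" "q (A $$ (i, j)) \<le> 2 ^ \<psi>" "q (b $ i) \<le> 2 ^ \<psi>"
    if "i \<in> T" "j < n" for i j
    using bitlength_bounds(1,2)[OF A b, of i j] bitlength_bounds(3)[OF A b, of i] that T(1) by (auto simp: p_def q_def \<psi>_def)
  obtain D :: nat where D: "D \<ge> 1" "int D \<le> fact n * (2 ^ (\<psi> * (n + 2))) ^ n"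
    "\<And>j. j < n \<Longrightarrow> real D * w j \<in> \<int>"
  proof (rule basic_solution_denominator[of T n g "2 ^ (\<psi> * (n + 2))" w])
    show "finite T" using T(1) finite_subset by blast
    show "trivial_kernel n T (\<lambda>i j. real_of_int (g i j))"
      unfolding trivial_kernel_def
    proof (intro allI impI)
      fix d j assume d: "\<forall>i\<in>T. (\<Sum>j<n. real_of_int (g i j) * d j) = 0" and j: "j < n"
      show "d j = 0"
      proof (rule trivial_kernelD[OF T(2) _ j])
        fix i assume "i \<in> T"
        then have "0 = (\<Sum>j<n. real_of_int (g i j) * d j)" using d by simp
        also have "\<dots> = real_of_int (Q i * q (b $ i)) * (\<Sum>j<n. ?a i j * d j)"
          unfolding sum_distrib_left by (rule sum.cong) (simp_all add: g mult.assoc)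
        finally show "(\<Sum>j<n. ?a i j * d j) = 0"
          using Q0[of i] q0[of "b $ i"] by simp
      qed
    qed
    \<comment> \<open>The exponent counts one numerator, at most \<open>n\<close> denominators of
      entries in the row and one denominator of the right-hand side, each bounded by
      \<open>2 ^ \<psi>\<close>.\<close>
    show "\<bar>g i j\<bar> \<le> 2 ^ (\<psi> * (n + 2))" if ij: "i \<in> T" "j < n" for i j
    proof -
      have "\<bar>\<Prod>l\<in>{..<n} - {j}. q (A $$ (i, l))\<bar> = (\<Prod>l\<in>{..<n} - {j}. q (A $$ (i, l)))"
        by (intro abs_of_nonneg prod_nonneg) (use q0 less_imp_le in blast)
      also have "\<dots> \<le> (\<Prod>l\<in>{..<n} - {j}. 2 ^ \<psi>)"
        by (rule prod_mono) (use bnd(2)[OF ij(1)] q0 in \<open>auto simp: less_imp_le\<close>)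
      also have "\<dots> = (2 ^ \<psi>) ^ (n - 1)" using ij by simp
      also have "\<dots> \<le> (2 ^ \<psi>) ^ n" by (rule power_increasing) auto
      finally have "\<bar>g i j\<bar> \<le> 2 ^ \<psi> * (2 ^ \<psi>) ^ n * 2 ^ \<psi>"
        unfolding g_def abs_mult using bnd(1,3)[OF ij] q0[of "b $ i"] by (intro mult_mono) auto
      also have "\<dots> = 2 ^ (\<psi> * (n + 2))" by (simp add: power_add power_mult[symmetric] algebra_simps power2_eq_square)
      finally show ?thesis .
    qed
    show "(\<Sum>j<n. real_of_int (g i j) * w j) \<in> \<int>" if "i \<in> T" for i
    proof -
      have "(\<Sum>j<n. real_of_int (g i j) * w j) = real_of_int (Q i * q (b $ i)) * (\<Sum>j<n. ?a i j * w j)"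
        unfolding sum_distrib_left by (rule sum.cong) (simp_all add: g mult.assoc)
      also have "\<dots> = real_of_int (Q i) * real_of_int (p (b $ i))"
        using T(3)[OF that] pq[of "b $ i"] by (simp add: mult.assoc)
      finally show ?thesis by simp
    qed
  qed (rule that)
  have "int D \<le> int (fact n * (2 ^ (\<psi> * (n + 2))) ^ n)" using D(2) by simp
  then show ?thesis using that D(1,3) unfolding \<psi>_def by (simp only: of_nat_le_iff)
qed

lemma ehrhart_saturated:
  assumes A: "A \<in> carrier_mat m n" and b: "b \<in> carrier_vec m"
    and bd: "bounded_in n (solution_set n A b)"
  defines "f \<equiv> \<lambda>k. real (ehrhart n (solution_set n A b) k)"
    and "s \<equiv> n * (fact n * (2 ^ (max_bitlength A b * (n + 2))) ^ n) ^ (n + 1)"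
  shows "quasi_polynomial f" "strictly_saturated (\<lambda>k. f (k + s))"
proof -
  let ?a = "\<lambda>i j. real_of_rat (A $$ (i, j))" and ?b = "\<lambda>i. real_of_rat (b $ i)"
  define V where "V = basic_points n {..<m} ?a ?b"
  define r where "r = card V"
  define M :: nat where "M = fact n * (2 ^ (max_bitlength A b * (n + 2))) ^ n"
  have finV: "finite V" unfolding V_def by (rule finite_basic_points) simp
  obtain v where v: "bij_betw v {..<r} V"
    using bij_betw_from_nat_into_finite[OF finV] unfolding r_def by blast
  interpret point_configuration n r v .
  have "\<exists>D :: nat. 1 \<le> D \<and> D \<le> M \<and> (\<forall>c<n. real D * v i c \<in> \<int>)" if "i < r" for i
  proof -
    have "v i \<in> V" using v that by (auto simp: bij_betw_def)
    from basic_point_denominator[OF A b this[unfolded V_def]] show ?thesis unfolding M_def by metis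
  qed
  then obtain D :: "nat \<Rightarrow> nat" where D: "\<And>i. i < r \<Longrightarrow> 1 \<le> D i \<and> D i \<le> M"
      "\<And>i c. i < r \<Longrightarrow> c < n \<Longrightarrow> real (D i) * v i c \<in> \<int>" by metis
  have M: "M \<ge> 1" by (simp add: M_def)
  obtain l c where l: "l \<ge> 1" and c: "\<And>i j. [i = j] (mod l) \<Longrightarrow> c i = c j"
    and ck: "\<And>k. k \<ge> 1 \<Longrightarrow> real (card (dilate_points k)) = poly (c k) (real k)"
    and c0: "poly (c 0) 0 = (if r = 0 then 0 else 1)"
    and pos: "\<And>j x. c j \<noteq> 0 \<Longrightarrow> x > real (n * M ^ (n + 1)) \<Longrightarrow> poly (c j) x > 0"
    using dilate_points_quasi_polynomial[OF D(1) M D(2)] by blast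
  \<comment> \<open>Matches the two cases of the value at \<open>k = 0\<close>: the Euler
    characteristic on one side, the empty or one-point dilate on the other.\<close>
  have "r = 0 \<longleftrightarrow> solution_set n A b = {}"
    using basic_points_empty_iff[OF A b bd] finV unfolding r_def V_def by simp
  then have f: "f k = poly (c k) (real k)" for k
    using card_dilate_eq_ehrhart[OF A b bd V_def v, of k] ck[of k] c0 ehrhart_0[of "solution_set n A b" n]
    by (cases "k = 0") (auto simp: f_def solution_set_def)
  have s: "s = n * M ^ (n + 1)" by (simp add: s_def M_def)
  show "quasi_polynomial f" "strictly_saturated (\<lambda>k. f (k + s))"
    using quasi_polynomial_from_residues[OF l c f, of s] pos unfolding s by blast+
qed

text \<open>Uses \<open>fact n \<le> n ^ n\<close> and \<open>n \<le> 2 ^ n\<close>, then replaces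
  \<open>n\<close> and \<psi> by their sum \<open>N\<close>, so that the exponent is a polynomial in
  the size alone.\<close>

lemma saturation_bound_le:
  fixes n \<psi> :: nat
  defines "N \<equiv> n + \<psi>"
  shows "n * (fact n * (2 ^ (\<psi> * (n + 2))) ^ n) ^ (n + 1) \<le> 2 ^ (N ^ 4 + 4 * N ^ 3 + 3 * N ^ 2 + N)"
proof -
  have n2: "n \<le> 2 ^ n" by (simp add: less_imp_le)
  have "fact n \<le> n ^ n" using fact_le_power[of n, where ?'a = nat] by simp
  also have "\<dots> \<le> (2 ^ n) ^ n" using n2 by (rule power_mono) simp
  finally have "fact n * (2 ^ (\<psi> * (n + 2))) ^ n \<le> (2 ^ n) ^ n * ((2 :: nat) ^ (\<psi> * (n + 2))) ^ n"
    by (rule mult_right_mono) simp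
  also have "\<dots> = 2 ^ (n * n + \<psi> * (n + 2) * n)" by (simp add: power_add power_mult)
  finally have "(fact n * (2 ^ (\<psi> * (n + 2))) ^ n) ^ (n + 1) \<le> ((2 :: nat) ^ (n * n + \<psi> * (n + 2) * n)) ^ (n + 1)"
    by (rule power_mono) simp
  from n2 this have "n * (fact n * (2 ^ (\<psi> * (n + 2))) ^ n) ^ (n + 1)
      \<le> 2 ^ n * (2 ^ (n * n + \<psi> * (n + 2) * n)) ^ (n + 1)"
    by (rule mult_mono) simp_all
  also have "\<dots> = 2 ^ (n + (n * n + \<psi> * (n + 2) * n) * (n + 1))" by (simp add: power_add power_mult)
  also have "\<dots> \<le> 2 ^ (N + (N * N + N * (N + 2) * N) * (N + 1))"
    by (intro power_increasing add_mono mult_mono) (auto simp: N_def)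
  also have "N + (N * N + N * (N + 2) * N) * (N + 1) = N ^ 4 + 4 * N ^ 3 + 3 * N ^ 2 + N"
    by (simp add: algebra_simps power_numeral_reduce)
  finally show ?thesis .
qed

text \<open>The existence of some saturating shift is asserted separately, because
  \<open>saturation_index\<close> is a \<open>LEAST\<close> and would otherwise carry no
  information.\<close>

theorem theorem3p1p5:
  shows "\<exists>(C::real) (q::real poly) (D::real) (r::real poly).
    \<forall>(n::nat) (m::nat) (A::rat mat) (b::rat vec) (P::real vec set).
      A \<in> carrier_mat m n \<longrightarrow> b \<in> carrier_vec m \<longrightarrow>
      P = solution_set n A b \<longrightarrow> bounded_in n P \<longrightarrow>
      (let f = (\<lambda>k. real (ehrhart n P k)); N = real (polytope_size n A b) in
        quasi_polynomial f \<and>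
        (\<exists>s. strictly_saturated (\<lambda>k. f (k + s))) \<and>
        real (saturation_index f) \<le> C * 2 powr (poly q N) \<and>
        real (floorlog 2 (saturation_index f)) \<le> D * poly r N)"
\<comment> \<open>Both constants are \<open>1\<close>. The coefficients of \<open>q\<close> are
  those of the exponent in \<open>saturation_bound_le\<close>; the other polynomial is larger by
  \<open>1\<close> because \<open>2 ^ e\<close> has \<open>e + 1\<close> binary digits.\<close>
proof (rule exI[of _ 1], rule exI[of _ "[:0, 1, 3, 4, 1:]"], rule exI[of _ 1],
    rule exI[of _ "[:1, 1, 3, 4, 1:]"], intro allI impI)
  fix n m :: nat and A :: "rat mat" and b :: "rat vec" and P :: "real vec set"
  assume A: "A \<in> carrier_mat m n" and b: "b \<in> carrier_vec m" and P: "P = solution_set n A b"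
    and bd: "bounded_in n P"
  define f where "f k = real (ehrhart n P k)" for k
  define s where "s = n * (fact n * (2 ^ (max_bitlength A b * (n + 2))) ^ n) ^ (n + 1)"
  define N where "N = polytope_size n A b"
  define e where "e = N ^ 4 + 4 * N ^ 3 + 3 * N ^ 2 + N"
  have sat: "quasi_polynomial f" "strictly_saturated (\<lambda>k. f (k + s))"
    using ehrhart_saturated[OF A b] bd unfolding P f_def s_def by blast+
  have "saturation_index f \<le> s" unfolding saturation_index_def using sat(2) by (rule Least_le)
  also have "s \<le> 2 ^ e"
    using saturation_bound_le[of n "max_bitlength A b"] by (simp add: s_def e_def N_def polytope_size_def)
  finally have le: "saturation_index f \<le> 2 ^ e" .
  have e: "poly [:0, 1, 3, 4, 1:] (real N) = real e"
    by (simp add: e_def algebra_simps power_numeral_reduce)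
  have "real (saturation_index f) \<le> real (2 ^ e)" using le by (simp only: of_nat_le_iff)
  then have 1: "real (saturation_index f) \<le> 1 * 2 powr (poly [:0, 1, 3, 4, 1:] (real N))"
    unfolding e by (simp add: powr_realpow)
  have "saturation_index f < 2 ^ (e + 1)" using le by (rule le_less_trans) simp
  then have "floorlog 2 (saturation_index f) \<le> e + 1" by (intro floorlog_leI) auto
  then have "real (floorlog 2 (saturation_index f)) \<le> real e + 1" by linarith
  then have 2: "real (floorlog 2 (saturation_index f)) \<le> 1 * poly [:1, 1, 3, 4, 1:] (real N)"
    using e by simp
  show "let f = (\<lambda>k. real (ehrhart n P k)); N = real (polytope_size n A b) in
        quasi_polynomial f \<and> (\<exists>s. strictly_saturated (\<lambda>k. f (k + s))) \<and>
        real (saturation_index f) \<le> 1 * 2 powr (poly [:0, 1, 3, 4, 1:] N) \<and>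
        real (floorlog 2 (saturation_index f)) \<le> 1 * poly [:1, 1, 3, 4, 1:] N"
    using sat 1 2 unfolding Let_def f_def[abs_def] N_def by blast
qed

end
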